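(* For an integer $n\ge 2$ let $\mathrm{BS}(1,n)=\langle a,b \mid bab^{-1}=a^n\rangle$ be the Baumslag–Solitar group, and for a group $G$ let $E_{\mathsf{lo}}(G)$ be the orbit equivalence relation of the conjugation action of $G$ on its space of left-orderings $\mathrm{LO}(G)$. Then: (1) For all $n\ge 2$, the equivalence relation $E_{\mathsf{lo}}(\mathrm{BS}(1,n))$ is not smooth. (2) The equivalence relation $E_{\mathsf{lo}}(\mathrm{BS}(1,2))$ is Borel bi-reducible with $E_0$.
   Context: A positive cone of a group $G$ is a subset $P\subseteq G$ with $P\cdot P\subseteq P$ and $P\sqcup P^{-1}=G\setminus\{id\}$ (disjoint union). Positive cones correspond to left-orderings (strict total orders $<$ with $g<h\Rightarrow fg<fh$) via $P=\{g: g>id\}$. For a countable group $G$, $\mathrm{LO}(G)\subseteq\{0,1\}^G$ is the set of all positive cones with the subspace topology of the product topology ($\{0,1\}$ discrete); it is a compact Polish space. $G$ acts on $\mathrm{LO}(G)$ by homeomorphisms via $g\cdot P=gPg^{-1}$, and $E_{\mathsf{lo}}(G)$ is the orbit equivalence relation of this action. A Borel equivalence relation $E$ on a Polish space $X$ is smooth if there are a standard Borel space $Y$ and a Borel map $\theta\colon X\to Y$ such that $x_1\mathbin{E}x_2\iff\theta(x_1)=\theta(x_2)$. For Borel equivalence relations $E$ on $X$ and $F$ on $Y$, $E$ is Borel reducible to $F$ if there is a Borel map $f\colon X\to Y$ with $x_1\mathbin{E}x_2\iff f(x_1)\mathbin{F}f(x_2)$; $E$ and $F$ are Borel bi-reducible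 if each is Borel reducible to the other. $E_0$ is the equivalence relation of eventual equality on $\{0,1\}^{\mathbb{N}}$: $x\mathbin{E_0}y$ iff $x_i=y_i$ for all but finitely many $i$. *)

theory Defs
  imports "HOL-Analysis.Analysis" "HOL-Algebra.Group_Action"
begin

section \<open>Groups given by generators and relations\<close>

text \<open>The letter \<open>(x, True)\<close> stands for the generator \<open>x\<close> and \<open>(x, False)\<close> for its inverse.\<close>

type_synonym 'x gword = "('x \<times> bool) list"

text \<open>
  The congruence on words whose classes are the elements of the group presented by the
  equations \<open>u = v\<close> with \<open>(u, v) \<in> R\<close>.
\<close>

inductive pres_eq :: "('x gword \<times> 'x gword) set \<Rightarrow> 'x gword \<Rightarrow> 'x gword \<Rightarrow> bool"
  for R :: "('x gword \<times> 'x gword) set" where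
  refl: "pres_eq R u u"
| sym: "pres_eq R u v \<Longrightarrow> pres_eq R v u"
| trans: "pres_eq R u v \<Longrightarrow> pres_eq R v w \<Longrightarrow> pres_eq R u w"
| append: "pres_eq R u u' \<Longrightarrow> pres_eq R v v' \<Longrightarrow> pres_eq R (u @ v) (u' @ v')"
| cancel: "pres_eq R [(x, b), (x, \<not> b)] []"
| relation: "(u, v) \<in> R \<Longrightarrow> pres_eq R u v"

definition pres_class :: "('x gword \<times> 'x gword) set \<Rightarrow> 'x gword \<Rightarrow> 'x gword set" where
  "pres_class R w = {w'. pres_eq R w w'}"

definition presented_group :: "('x gword \<times> 'x gword) set \<Rightarrow> 'x gword set monoid" where
  "presented_group R =
     \<lparr>carrier = range (pres_class R),
      monoid.mult = (\<lambda>U V. {w. \<exists>u\<in>U. \<exists>v\<in>V. pres_eq R (u @ v) w}),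
      one = pres_class R []\<rparr>"

lemma pres_class_eq_iff: "pres_class R u = pres_class R v \<longleftrightarrow> pres_eq R u v"
  unfolding pres_class_def by (blast intro: pres_eq.refl pres_eq.sym pres_eq.trans)

lemma presented_group_mult:
  "pres_class R u \<otimes>\<^bsub>presented_group R\<^esub> pres_class R v = pres_class R (u @ v)"
  unfolding presented_group_def pres_class_def
  by (auto intro: pres_eq.refl pres_eq.append pres_eq.trans)

lemma presented_group_inv_word:
  "pres_eq R (rev (map (\<lambda>(x, b). (x, \<not> b)) w) @ w) []"
proof (induction w)
  case Nil
  show ?case by (simp add: pres_eq.refl)
next
  case (Cons p w)
  obtain x b where p: "p = (x, b)" by fastforce
  let ?i = "rev (map (\<lambda>(x, b). (x, \<not> b)) w)"
  have "pres_eq R ([(x, \<not> b), (x, b)]) []"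
    using pres_eq.cancel[of R x "\<not> b"] by simp
  then have "pres_eq R (?i @ ([(x, \<not> b), (x, b)] @ w)) (?i @ ([] @ w))"
    by (intro pres_eq.append pres_eq.refl)
  then show ?case
    using Cons.IH p by (auto intro: pres_eq.trans)
qed

lemma group_presented_group: "group (presented_group R)"
proof (rule groupI)
  let ?G = "presented_group R"
  have carrier: "carrier ?G = range (pres_class R)"
    and one: "\<one>\<^bsub>?G\<^esub> = pres_class R []"
    by (simp_all add: presented_group_def)
  show "U \<otimes>\<^bsub>?G\<^esub> V \<in> carrier ?G" if "U \<in> carrier ?G" "V \<in> carrier ?G" for U V
    using that by (auto simp: carrier presented_group_mult)
  show "\<one>\<^bsub>?G\<^esub> \<in> carrier ?G"
    by (simp add: carrier one)
  show "U \<otimes>\<^bsub>?G\<^esub> V \<otimes>\<^bsub>?G\<^esub> W = U \<otimes>\<^bsub>?G\<^esub> (V \<otimes>\<^bsub>?G\<^esub> W)"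
    if "U \<in> carrier ?G" "V \<in> carrier ?G" "W \<in> carrier ?G" for U V W
    using that by (auto simp: carrier presented_group_mult)
  show "\<one>\<^bsub>?G\<^esub> \<otimes>\<^bsub>?G\<^esub> U = U" if "U \<in> carrier ?G" for U
    using that by (auto simp: carrier one presented_group_mult)
  show "\<exists>V\<in>carrier ?G. V \<otimes>\<^bsub>?G\<^esub> U = \<one>\<^bsub>?G\<^esub>" if U: "U \<in> carrier ?G" for U
  proof -
    obtain w where "U = pres_class R w"
      using U carrier by auto
    then have "pres_class R (rev (map (\<lambda>(x, b). (x, \<not> b)) w)) \<otimes>\<^bsub>?G\<^esub> U = \<one>\<^bsub>?G\<^esub>"
      by (simp add: presented_group_mult one pres_class_eq_iff presented_group_inv_word)
    then show ?thesis
      using carrier by blast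
  qed
qed

datatype bs_gen = gen_a | gen_b

text \<open>\<open>BS(1,n) = \<langle>a, b | b a b\<^sup>-\<^sup>1 = a\<^sup>n\<rangle>\<close>\<close>

definition BS1 :: "nat \<Rightarrow> bs_gen gword set monoid" where
  "BS1 n = presented_group
     {([(gen_b, True), (gen_a, True), (gen_b, False)], replicate n (gen_a, True))}"


section \<open>The space of left-orderings\<close>

definition positive_cone :: "('g, 'm) monoid_scheme \<Rightarrow> 'g set \<Rightarrow> bool" where
  "positive_cone G P \<longleftrightarrow>
     P \<subseteq> carrier G \<and>
     P <#>\<^bsub>G\<^esub> P \<subseteq> P \<and>
     P \<inter> set_inv\<^bsub>G\<^esub> P = {} \<and>
     P \<union> set_inv\<^bsub>G\<^esub> P = carrier G - {\<one>\<^bsub>G\<^esub>}"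

definition LO :: "('g, 'm) monoid_scheme \<Rightarrow> 'g set set" where
  "LO G = {P. positive_cone G P}"

text \<open>
  A cone is a subset of the carrier and is identified with its indicator function on the
  carrier.  This identification is injective on \<open>LO G\<close>, so the pullback below is the subspace
  topology inherited from the product \<open>{0,1}\<^sup>G\<close> of discrete two-point spaces.
\<close>

definition LO_topology :: "('g, 'm) monoid_scheme \<Rightarrow> 'g set topology" where
  "LO_topology G =
     pullback_topology (LO G)
       (\<lambda>P. restrict (\<lambda>g. g \<in> P) (carrier G))
       (product_topology (\<lambda>_. discrete_topology (UNIV :: bool set)) (carrier G))"

lemma topspace_LO_topology: "topspace (LO_topology G) = LO G"
  by (auto simp: LO_topology_def topspace_pullback_topology)

definition conj_action :: "('g, 'm) monoid_scheme \<Rightarrow> 'g \<Rightarrow> 'g set \<Rightarrow> 'g set" where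
  "conj_action G g P = g <#\<^bsub>G\<^esub> P #>\<^bsub>G\<^esub> inv\<^bsub>G\<^esub> g"

definition E_lo :: "('g, 'm) monoid_scheme \<Rightarrow> 'g set \<Rightarrow> 'g set \<Rightarrow> bool" where
  "E_lo G P Q \<longleftrightarrow> P \<in> LO G \<and> Q \<in> LO G \<and> Q \<in> orbit G (conj_action G) P"


section \<open>Smoothness and Borel reducibility\<close>

definition borel_of :: "'x topology \<Rightarrow> 'x measure" where
  "borel_of X = sigma (topspace X) {U. openin X U}"

definition polish_topology :: "'x topology \<Rightarrow> bool" where
  "polish_topology X \<longleftrightarrow> completely_metrizable_space X \<and> separable_space X"

text \<open>Only the underlying \<open>\<sigma>\<close>-algebra of the measure \<open>M\<close> matters here.\<close>

definition standard_borel :: "'x measure \<Rightarrow> bool" where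
  "standard_borel M \<longleftrightarrow> (\<exists>X. polish_topology X \<and> sets M = sets (borel_of X))"

text \<open>
  HOL cannot quantify over types inside a formula, so the type of the standard Borel space
  \<open>Y\<close> is a parameter.  Smoothness in the usual sense means \<open>smooth_on TYPE('y) X E\<close> for some
  type \<open>'y\<close>, and failure of smoothness means \<open>\<not> smooth_on TYPE('y) X E\<close> for all types \<open>'y\<close>,
  as expressed by a free type variable.
\<close>

definition smooth_on :: "'y itself \<Rightarrow> 'x topology \<Rightarrow> ('x \<Rightarrow> 'x \<Rightarrow> bool) \<Rightarrow> bool" where
  "smooth_on _ X E \<longleftrightarrow>
     (\<exists>(Y :: 'y measure) \<theta>. standard_borel Y \<and> \<theta> \<in> measurable (borel_of X) Y \<and>
        (\<forall>x1\<in>topspace X. \<forall>x2\<in>topspace X. E x1 x2 \<longleftrightarrow> \<theta> x1 = \<theta> x2))"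

definition borel_reducible ::
    "'x topology \<Rightarrow> ('x \<Rightarrow> 'x \<Rightarrow> bool) \<Rightarrow> 'y topology \<Rightarrow> ('y \<Rightarrow> 'y \<Rightarrow> bool) \<Rightarrow> bool" where
  "borel_reducible X E Y F \<longleftrightarrow>
     (\<exists>f \<in> measurable (borel_of X) (borel_of Y).
        \<forall>x1\<in>topspace X. \<forall>x2\<in>topspace X. E x1 x2 \<longleftrightarrow> F (f x1) (f x2))"

definition borel_bireducible ::
    "'x topology \<Rightarrow> ('x \<Rightarrow> 'x \<Rightarrow> bool) \<Rightarrow> 'y topology \<Rightarrow> ('y \<Rightarrow> 'y \<Rightarrow> bool) \<Rightarrow> bool" where
  "borel_bireducible X E Y F \<longleftrightarrow> borel_reducible X E Y F \<and> borel_reducible Y F X E"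

definition cantor_space :: "(nat \<Rightarrow> bool) topology" where
  "cantor_space = product_topology (\<lambda>_. discrete_topology (UNIV :: bool set)) UNIV"

definition E0 :: "(nat \<Rightarrow> bool) \<Rightarrow> (nat \<Rightarrow> bool) \<Rightarrow> bool" where
  "E0 x y \<longleftrightarrow> finite {i. x i \<noteq> y i}"

end

theory Submission
  imports Defs "HOL-Probability.Probability"
begin

text \<open>
The group \<open>BS(1,n)\<close> is the group of affine maps \<open>t \<mapsto> n\<^sup>k t + x\<close> of the real line with
\<open>k \<in> \<int>\<close> and \<open>x \<in> \<int>[1/n]\<close>: \<open>a\<close> is the translation by \<open>1\<close>, and \<open>b\<close> is multiplication by \<open>n\<close>
(\<open>affine_coordinates_BS1\<close>, by the normal form \<open>b\<^sup>-\<^sup>i a\<^sup>m b\<^sup>k\<close>).  All further arguments use only these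
coordinates.

The left-orderings come from points of the line.  A point \<open>t\<close> gives the cone of all \<open>g\<close> with
\<open>g(t) > t\<close>, where an element fixing \<open>t\<close> counts as positive if it expands.  Conversely, let \<open>P\<close> be a
cone in which \<open>a\<close> is positive.  The centres of the positive homotheties of ratio \<open>n\<close> form an initial
segment of \<open>\<int>[1/n]\<close>, and its supremum, the axis of \<open>P\<close>, is a point of the extended line.  Each
expanding element is a translation times a power of a homothety, so its sign is the sign of
the axis relative to its fixed point.  The cone is therefore determined by its axis and by the
common sign of the expanding elements that fix the axis.  A cone in which \<open>a\<close> is negative is treated through its
opposite.  Conjugation by \<open>g\<close> moves the axis by \<open>g\<close> and keeps the two signs.  Thus
\<open>E_lo_classification\<close> turns \<open>E_lo\<close> into the orbit equivalence of the affine group on the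
extended line, together with two binary invariants.

Two real numbers are in one orbit exactly when their base-\<open>n\<close> digit sequences have a common
tail, up to a shift (\<open>tail_eq_digit_iff\<close>): multiplication by \<open>n\<close> shifts the digits, and adding an element of
\<open>\<int>[1/n]\<close> changes, after a shift, only the integer part.  So everything reduces to tail equivalence of sequences over a
finite alphabet.

Tail equivalence reduces to \<open>E\<^sub>0\<close> (\<open>tail_eq_iff_E0\<close>).  The least words that recur infinitely often
in a sequence \<open>x\<close> form a chain depending only on the tail class of \<open>x\<close>.  If \<open>x\<close> is tail equivalent
to the limit of the chain, then the chain alone determines the class.  Otherwise the first occurrences
of these words cut \<open>x\<close> into finite segments.  From any index on, the segments spell out a tail of \<open>x\<close>,
and tail equivalent sequences have the same segments from some index on.
Hence \<open>E_lo\<close> reduces to \<open>E\<^sub>0\<close>.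

For the reduction of \<open>E\<^sub>0\<close> to \<open>E_lo\<close>, a binary sequence is written into the digits of a real number at
rapidly growing positions.  The growing gaps prevent two such digit sequences from overlapping
after a nontrivial shift, so tail equivalence of the digits is \<open>E\<^sub>0\<close>
(\<open>tail_eq_marker_iff\<close>).  They also make the stabilizer of the number trivial, and for this
reason the cone depends continuously on the binary sequence.  Finally \<open>E\<^sub>0\<close> is not smooth by Kolmogorov's zero-one law
(\<open>E0_not_smooth\<close>), and the reduction carries this over to \<open>E_lo\<close>.
\<close>

section \<open>Tail equivalence reduces to eventual equality\<close>

text \<open>
The two tails may start at different positions, and this is the difference from \<open>E0\<close>.
\<close>

definition tail_eq :: "(nat \<Rightarrow> 'a) \<Rightarrow> (nat \<Rightarrow> 'a) \<Rightarrow> bool" where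
  "tail_eq x y \<longleftrightarrow> (\<exists>i j. \<forall>l. x (i + l) = y (j + l))"

lemma tail_eq_sym: "tail_eq x y \<Longrightarrow> tail_eq y x"
  unfolding tail_eq_def by metis

lemma tail_eq_trans:
  assumes "tail_eq x y" "tail_eq y z"
  shows "tail_eq x z"
proof -
  obtain i j where ij: "\<And>l. x (i + l) = y (j + l)"
    using assms(1) unfolding tail_eq_def by blast
  obtain p q where pq: "\<And>l. y (p + l) = z (q + l)"
    using assms(2) unfolding tail_eq_def by blast
  have "x ((i + p) + l) = z ((q + j) + l)" for l
    using ij[of "p + l"] pq[of "j + l"] by (simp add: ac_simps)
  then show ?thesis
    unfolding tail_eq_def by blast
qed

definition occurs :: "(nat \<Rightarrow> nat) \<Rightarrow> nat list \<Rightarrow> nat \<Rightarrow> bool" where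
  "occurs x w i \<longleftrightarrow> (\<forall>l<length w. x (i + l) = w ! l)"

definition recurs :: "(nat \<Rightarrow> nat) \<Rightarrow> nat list \<Rightarrow> bool" where
  "recurs x w \<longleftrightarrow> (\<forall>m. \<exists>i\<ge>m. occurs x w i)"

text \<open>
The choice of the least letter makes the word canonical: it depends only on which words recur,
and this is the same for all tail equivalent sequences.
\<close>

primrec stem :: "(nat \<Rightarrow> nat) \<Rightarrow> nat \<Rightarrow> nat list" where
  "stem x 0 = []"
| "stem x (Suc n) = stem x n @ [LEAST d. recurs x (stem x n @ [d])]"

text \<open>
For a sequence with finitely many letters, this is the lexicographically least limit point of its shifts.
\<close>

definition stem_limit :: "(nat \<Rightarrow> nat) \<Rightarrow> nat \<Rightarrow> nat" where
  "stem_limit x l = stem x (Suc l) ! l"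

lemma length_stem [simp]: "length (stem x n) = n"
  by (induction n) auto

lemma nth_stem: "l < n \<Longrightarrow> stem x n ! l = stem_limit x l"
proof (induction n)
  case (Suc n)
  then show ?case
    by (cases "l = n") (auto simp: stem_limit_def nth_append)
qed simp

lemma occurs_stem: "occurs x (stem x n) i \<longleftrightarrow> (\<forall>l<n. x (i + l) = stem_limit x l)"
  by (auto simp: occurs_def nth_stem)

text \<open>
Finitely many letters can follow the infinitely many occurrences of \<open>w\<close>, so by the pigeonhole principle one of
them follows infinitely often.
\<close>

lemma recurs_append:
  assumes bounded: "\<forall>i. x i < B" and "recurs x w"
  shows "\<exists>d. recurs x (w @ [d])"
proof (rule ccontr)
  assume "\<not> ?thesis"
  then have "\<forall>d. \<exists>m. \<forall>i\<ge>m. \<not> occurs x (w @ [d]) i"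
    by (auto simp: recurs_def)
  then obtain m where m: "\<And>d i. i \<ge> m d \<Longrightarrow> \<not> occurs x (w @ [d]) i"
    by metis
  obtain i where i: "i \<ge> Max (m ` {..<B})" "occurs x w i"
    using assms(2) unfolding recurs_def by blast
  have "occurs x (w @ [x (i + length w)]) i"
    using i(2) by (auto simp: occurs_def nth_append less_Suc_eq)
  moreover have "m (x (i + length w)) \<le> Max (m ` {..<B})"
    by (intro Max_ge) (auto simp: bounded)
  ultimately show False
    using m i(1) le_trans by blast
qed

lemma recurs_stem:
  assumes bounded: "\<forall>i. x i < B"
  shows "recurs x (stem x n)"
proof (induction n)
  case 0
  show ?case by (auto simp: recurs_def occurs_def)
next
  case (Suc n)
  have "\<exists>d. recurs x (stem x n @ [d])"
    by (rule recurs_append[OF bounded Suc.IH])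
  from LeastI_ex[OF this] show ?case by simp
qed

lemma recurs_shift: "recurs (\<lambda>l. x (i + l)) w \<longleftrightarrow> recurs x w"
proof -
  have occ: "occurs (\<lambda>l. x (i + l)) w k \<longleftrightarrow> occurs x w (i + k)" for k
    by (simp add: occurs_def add.assoc)
  show ?thesis
  proof
    assume *: "recurs (\<lambda>l. x (i + l)) w"
    then show "recurs x w"
      unfolding recurs_def occ by (meson le_add2 le_trans)
  next
    assume *: "recurs x w"
    show "recurs (\<lambda>l. x (i + l)) w"
      unfolding recurs_def occ
    proof
      fix m
      obtain k where "k \<ge> i + m" "occurs x w k"
        using * unfolding recurs_def by blast
      then show "\<exists>k\<ge>m. occurs x w (i + k)"
        by (intro exI[of _ "k - i"]) auto
    qed
  qed
qed

lemma stem_tail_eq: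
  assumes "tail_eq x y"
  shows "stem x n = stem y n"
proof -
  obtain i j where ij: "(\<lambda>l. x (i + l)) = (\<lambda>l. y (j + l))"
    using assms unfolding tail_eq_def by blast
  have "recurs x w \<longleftrightarrow> recurs y w" for w
    using recurs_shift[of x i w] recurs_shift[of y j w] ij by simp
  then show ?thesis
    by (induction n) auto
qed

lemma stem_limit_tail_eq: "tail_eq x y \<Longrightarrow> stem_limit x = stem_limit y"
  unfolding stem_limit_def using stem_tail_eq by metis

definition first_occ :: "(nat \<Rightarrow> nat) \<Rightarrow> nat \<Rightarrow> nat" where
  "first_occ x n = (LEAST i. occurs x (stem x n) i)"

definition segment :: "(nat \<Rightarrow> nat) \<Rightarrow> nat \<Rightarrow> nat list" where
  "segment x n = map x [first_occ x n..<first_occ x (Suc n)]"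

text \<open>
The stems alone identify the tail class of a sequence that is tail equivalent to its stem limit.
In this case the segments must be dropped: the first occurrences can stay bounded for one
sequence of the class and go to infinity for another one.
\<close>

definition tail_code :: "(nat \<Rightarrow> nat) \<Rightarrow> nat \<Rightarrow> nat list \<times> nat list" where
  "tail_code x n = (stem x n, if tail_eq x (stem_limit x) then [] else segment x n)"

lemma occurs_first_occ:
  assumes "\<forall>i. x i < B"
  shows "occurs x (stem x n) (first_occ x n)"
  unfolding first_occ_def
  by (rule LeastI_ex) (use recurs_stem[OF assms, of n] in \<open>auto simp: recurs_def\<close>)

lemma first_occ_le: "occurs x (stem x n) i \<Longrightarrow> first_occ x n \<le> i"
  unfolding first_occ_def by (rule Least_le)

lemma first_occ_Suc:
  assumes "\<forall>i. x i < B"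
  shows "first_occ x n \<le> first_occ x (Suc n)"
  using occurs_first_occ[OF assms, of "Suc n"]
  by (intro first_occ_le) (simp add: occurs_stem del: stem.simps)

lemma first_occ_mono:
  assumes "\<forall>i. x i < B" "m \<le> n"
  shows "first_occ x m \<le> first_occ x n"
  using lift_Suc_mono_le[of "first_occ x" m n] first_occ_Suc[OF assms(1)] assms(2) by blast

text \<open>
If the first occurrences were bounded, then they would be constant from some index on, and all
stems would occur at one position, where the stem limit would begin.
\<close>

lemma first_occ_unbounded:
  assumes B: "\<forall>i. x i < B" and "\<not> tail_eq x (stem_limit x)"
  shows "\<exists>N. \<forall>n\<ge>N. m \<le> first_occ x n"
proof (rule ccontr)
  assume "\<not> ?thesis"
  then have less: "first_occ x n < m" for n
    by (meson B first_occ_mono le_trans not_less)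
  then have fin: "finite (range (first_occ x))"
    by (meson finite_nat_iff_bounded lessThan_iff image_subsetI)
  then obtain N where N: "first_occ x N = Max (range (first_occ x))"
    using Max_in by (metis (no_types, lifting) empty_is_image UNIV_not_empty image_iff)
  have eq: "first_occ x n = first_occ x N" if "n \<ge> N" for n
    using first_occ_mono[OF B that] N fin by (metis Max_ge le_antisym rangeI)
  have "x (first_occ x N + l) = stem_limit x (0 + l)" for l
    using occurs_first_occ[OF B, of "max N (Suc l)"] eq[of "max N (Suc l)"]
    by (auto simp: occurs_stem)
  then show False
    using assms(2) unfolding tail_eq_def by blast
qed

text \<open>
Once the first occurrences lie in the common tail of \<open>x\<close> and \<open>y\<close>, they are at the same places of this tail, since
the stems are the same words.
\<close>

lemma tail_code_eq_if_tail_eq: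
  assumes B: "\<forall>i. x i < B" "\<forall>i. y i < B" and "tail_eq x y"
  shows "\<exists>N. \<forall>n\<ge>N. tail_code x n = tail_code y n"
proof -
  obtain i j where ij: "\<And>l. x (i + l) = y (j + l)"
    using assms(3) unfolding tail_eq_def by blast
  have lim: "stem_limit x = stem_limit y" and stem: "stem x n = stem y n" for n
    using assms(3) by (auto intro: stem_limit_tail_eq stem_tail_eq)
  have iff: "tail_eq x (stem_limit x) \<longleftrightarrow> tail_eq y (stem_limit y)"
    using assms(3) lim by (metis tail_eq_sym tail_eq_trans)
  show ?thesis
  proof (cases "tail_eq x (stem_limit x)")
    case True
    then show ?thesis using iff stem by (auto simp: tail_code_def)
  next
    case False
    obtain N where Nx: "\<And>n. n \<ge> N \<Longrightarrow> i \<le> first_occ x n"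
      using first_occ_unbounded[OF B(1) False] by blast
    obtain M where Ny: "\<And>n. n \<ge> M \<Longrightarrow> j \<le> first_occ y n"
      using first_occ_unbounded[OF B(2)] False iff by blast
    have occ: "occurs x w (i + k) \<longleftrightarrow> occurs y w (j + k)" for w k
      using ij by (simp add: occurs_def add.assoc)
    have eq: "first_occ x n - i = first_occ y n - j" if "n \<ge> N" "n \<ge> M" for n
    proof (rule antisym)
      have "occurs y (stem y n) (j + (first_occ x n - i))"
        using occurs_first_occ[OF B(1), of n] Nx[OF that(1)]
          occ[of "stem x n" "first_occ x n - i"] stem[of n] by simp
      then show "first_occ y n - j \<le> first_occ x n - i"
        using first_occ_le by fastforce
      have "occurs x (stem x n) (i + (first_occ y n - j))"
        using occurs_first_occ[OF B(2), of n] Ny[OF that(2)]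
          occ[of "stem y n" "first_occ y n - j"] stem[of n] by simp
      then show "first_occ x n - i \<le> first_occ y n - j"
        using first_occ_le by fastforce
    qed
    have "segment x n = segment y n" if n: "n \<ge> N" "n \<ge> M" for n
    proof (rule nth_equalityI)
      have *: "first_occ x n - i = first_occ y n - j"
        "first_occ x (Suc n) - i = first_occ y (Suc n) - j"
        using eq n by simp_all
      have **: "i \<le> first_occ x n" "i \<le> first_occ x (Suc n)"
        "j \<le> first_occ y n" "j \<le> first_occ y (Suc n)"
        using Nx Ny n by simp_all
      show "length (segment x n) = length (segment y n)"
        unfolding segment_def using * ** by simp
      show "segment x n ! l = segment y n ! l" if "l < length (segment x n)" for l
      proof -
        have "i + (first_occ x n - i + l) = first_occ x n + l"
          "j + (first_occ x n - i + l) = first_occ y n + l"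
          using * ** by simp_all
        then have "x (first_occ x n + l) = y (first_occ y n + l)"
          using ij[of "first_occ x n - i + l"] by simp
        then show ?thesis
          using that * ** unfolding segment_def by simp
      qed
    qed
    then show ?thesis
      using stem iff by (intro exI[of _ "max N M"]) (simp add: tail_code_def)
  qed
qed

lemma tail_eq_limit_if_segments_empty:
  assumes B: "\<forall>i. x i < B" and "\<And>n. n \<ge> N \<Longrightarrow> segment x n = []"
  shows "tail_eq x (stem_limit x)"
proof (rule ccontr)
  assume "\<not> ?thesis"
  then obtain M where M: "\<And>n. n \<ge> M \<Longrightarrow> Suc (first_occ x N) \<le> first_occ x n"
    using first_occ_unbounded[OF B] by blast
  have "first_occ x (Suc n) \<le> first_occ x n" if "n \<ge> N" for n
    using assms(2)[OF that] by (auto simp: segment_def)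
  then have "first_occ x (N + Suc m) \<le> first_occ x (N + m)" for m
    by simp
  then have "first_occ x (N + m) \<le> first_occ x N" for m
    by (induction m) (auto intro: le_trans simp del: add_Suc_right)
  then show False
    using M[of "N + M"] by (meson le_add2 not_less_eq_eq)
qed

text \<open>
The segments from index \<open>N\<close> on, put together, are the tail of the sequence that starts at
its first occurrence with index \<open>N\<close>.  So equal segments give equal tails.
\<close>

lemma tail_eq_if_tail_code_eq:
  assumes B: "\<forall>i. x i < B" "\<forall>i. y i < B"
    and N: "\<And>n. n \<ge> N \<Longrightarrow> tail_code x n = tail_code y n"
  shows "tail_eq x y"
proof -
  have stem: "stem x n = stem y n" if "n \<ge> N" for n
    using N[OF that] by (simp add: tail_code_def)
  have lim: "stem_limit x = stem_limit y"
  proof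
    fix l
    show "stem_limit x l = stem_limit y l"
      using stem[of "max N (Suc l)"] nth_stem[of l "max N (Suc l)" x]
        nth_stem[of l "max N (Suc l)" y] by simp
  qed
  consider "tail_eq x (stem_limit x)" "tail_eq y (stem_limit y)"
    | "tail_eq x (stem_limit x)" "\<not> tail_eq y (stem_limit y)"
    | "\<not> tail_eq x (stem_limit x)" "tail_eq y (stem_limit y)"
    | "\<not> tail_eq x (stem_limit x)" "\<not> tail_eq y (stem_limit y)" by blast
  then show ?thesis
  proof cases
    case 1
    then show ?thesis using lim by (metis tail_eq_sym tail_eq_trans)
  next
    case 2
    then have "segment y n = []" if "n \<ge> N" for n
      using N[OF that] by (simp add: tail_code_def)
    then show ?thesis
      using tail_eq_limit_if_segments_empty[OF B(2)] 2(2) by blast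
  next
    case 3
    then have "segment x n = []" if "n \<ge> N" for n
      using N[OF that] by (simp add: tail_code_def)
    then show ?thesis
      using tail_eq_limit_if_segments_empty[OF B(1)] 3(1) by blast
  next
    case 4
    then have seg: "segment x n = segment y n" if "n \<ge> N" for n
      using N[OF that] by (simp add: tail_code_def)
    define p q where "p = first_occ x N" and "q = first_occ y N"
    have le: "p \<le> first_occ x (N + m)" "q \<le> first_occ y (N + m)" for m
      unfolding p_def q_def using first_occ_mono[of x B N "N + m"] first_occ_mono[of y B N "N + m"] B by auto
    have "first_occ x (N + m) - p = first_occ y (N + m) - q \<and>
      (\<forall>l<first_occ x (N + m) - p. x (p + l) = y (q + l))" for m
    proof (induction m)
      case 0
      show ?case by (simp add: p_def q_def)
    next
      case (Suc m)
      let ?a = "first_occ x (N + m)" let ?a' = "first_occ x (Suc (N + m))"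
      let ?b = "first_occ y (N + m)" let ?b' = "first_occ y (Suc (N + m))"
      have *: "?a \<le> ?a'" "?b \<le> ?b'"
        using first_occ_Suc[OF B(1)] first_occ_Suc[OF B(2)] by auto
      have s: "map x [?a..<?a'] = map y [?b..<?b']"
        using seg[of "N + m"] by (simp add: segment_def)
      then have len: "?a' - ?a = ?b' - ?b"
        by (metis length_map length_upt)
      have nth: "x (?a + l) = y (?b + l)" if "l < ?a' - ?a" for l
        using arg_cong[OF s, of "\<lambda>w. w ! l"] that len by simp
      have "x (p + l) = y (q + l)" if "l < ?a' - p" for l
      proof (cases "l < ?a - p")
        case True
        then show ?thesis using Suc.IH by blast
      next
        case False
        then have "p + l = ?a + (l - (?a - p))" "q + l = ?b + (l - (?a - p))"
          "l - (?a - p) < ?a' - ?a"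
          using that Suc.IH le[of m] * by auto
        then show ?thesis using nth by metis
      qed
      moreover have "?a' - p = ?b' - q"
        using len Suc.IH * le[of m] by linarith
      ultimately show ?case by simp
    qed
    then have agree: "x (p + l) = y (q + l)" if "l < first_occ x (N + m) - p" for l m
      using that by blast
    have "x (p + l) = y (q + l)" for l
    proof -
      obtain M where "\<And>n. n \<ge> M \<Longrightarrow> Suc (p + l) \<le> first_occ x n"
        using first_occ_unbounded[OF B(1) 4(1)] by blast
      then have "l < first_occ x (N + M) - p"
        using le_add2[of M N] by (metis Suc_le_eq less_diff_conv add.commute)
      then show ?thesis by (rule agree)
    qed
    then show ?thesis unfolding tail_eq_def by blast
  qed
qed

text \<open>
The characteristic function of the graph of \<open>e\<close>.  It replaces a countable alphabet by a binary one,
since two graphs differ in finitely many points exactly when the functions do.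
\<close>

definition graph_code :: "(nat \<Rightarrow> 'a::countable) \<Rightarrow> nat \<Rightarrow> bool" where
  "graph_code e k \<longleftrightarrow> (\<exists>n. k = to_nat (n, e n))"

lemma E0_graph_code: "E0 (graph_code e) (graph_code f) \<longleftrightarrow> (\<exists>N. \<forall>n\<ge>N. e n = f n)"
proof -
  define D where "D = {n. e n \<noteq> f n}"
  have "{k. graph_code e k \<noteq> graph_code f k} =
      (\<lambda>n. to_nat (n, e n)) ` D \<union> (\<lambda>n. to_nat (n, f n)) ` D"
    unfolding graph_code_def D_def by (auto simp: image_iff)
  moreover have "inj (\<lambda>n. to_nat (n, g n))" for g :: "nat \<Rightarrow> 'a"
    by (auto simp: inj_def)
  then have "finite ((\<lambda>n. to_nat (n, g n)) ` D) \<longleftrightarrow> finite D" for g :: "nat \<Rightarrow> 'a"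
    by (meson finite_image_iff inj_on_subset subset_UNIV)
  ultimately have "E0 (graph_code e) (graph_code f) \<longleftrightarrow> finite D"
    by (simp add: E0_def)
  also have "\<dots> \<longleftrightarrow> (\<exists>N. \<forall>n\<ge>N. e n = f n)"
    unfolding D_def finite_nat_set_iff_bounded by (auto simp: not_le[symmetric])
  finally show ?thesis .
qed

text \<open>
Tail equivalence over a finite alphabet reduces to \<open>E0\<close>, even though the segments are words of
unbounded length: they are still letters of a countable alphabet.
\<close>

theorem tail_eq_iff_E0:
  assumes "\<forall>i. x i < B" "\<forall>i. y i < B"
  shows "tail_eq x y \<longleftrightarrow> E0 (graph_code (tail_code x)) (graph_code (tail_code y))"
  unfolding E0_graph_code
  using tail_code_eq_if_tail_eq[OF assms] tail_eq_if_tail_code_eq[OF assms] by blast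

section \<open>Borel maps into Cantor space\<close>

lemma openin_cantor_cylinder:
  assumes "openin cantor_space U" "x \<in> U"
  shows "\<exists>n. {y. \<forall>i<n. y i = x i} \<subseteq> U"
proof -
  obtain V where V: "finite {i. V i \<noteq> (UNIV :: bool set)}" "x \<in> Pi\<^sub>E UNIV V" "Pi\<^sub>E UNIV V \<subseteq> U"
    using assms unfolding cantor_space_def openin_product_topology_alt by fastforce
  obtain n where n: "\<And>i. V i \<noteq> UNIV \<Longrightarrow> i < n"
    using V(1) unfolding finite_nat_set_iff_bounded by blast
  have "y i \<in> V i" if "\<forall>i<n. y i = x i" for y i
    using that V(2) n[of i] by (cases "V i = UNIV") (auto simp: PiE_iff)
  then show ?thesis
    using V(3) by (intro exI[of _ n]) (auto simp: subset_iff PiE_iff)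
qed

text \<open>
There are only countably many cylinders, so every open set is a countable union of cylinders.
\<close>

lemma sets_borel_of_cantor:
  "sets (borel_of cantor_space) = sets (PiM UNIV (\<lambda>_::nat. count_space (UNIV :: bool set)))"
proof -
  let ?P = "PiM UNIV (\<lambda>_::nat. count_space (UNIV :: bool set))"
  have top: "topspace cantor_space = UNIV"
    by (simp add: cantor_space_def)
  have spaceP: "space ?P = UNIV"
    by (simp add: space_PiM)
  have borel: "sets (borel_of cantor_space) = sigma_sets UNIV {U. openin cantor_space U}"
    unfolding borel_of_def top by (subst sets_measure_of) auto
  show ?thesis
  proof
    have "U \<in> sets ?P" if U: "openin cantor_space U" for U
    proof -
      let ?C = "\<lambda>w :: bool list. {y. \<forall>i<length w. y i = w ! i}"
      have "{y \<in> space ?P. \<forall>i<length w. y i = w ! i} \<in> sets ?P" for w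
        by measurable
      then have cyl: "?C w \<in> sets ?P" for w
        by (simp add: spaceP)
      have "U = (\<Union>w\<in>{w. ?C w \<subseteq> U}. ?C w)"
      proof
        show "U \<subseteq> (\<Union>w\<in>{w. ?C w \<subseteq> U}. ?C w)"
        proof
          fix x assume "x \<in> U"
          then obtain n where n: "{y. \<forall>i<n. y i = x i} \<subseteq> U"
            using openin_cantor_cylinder[OF U] by blast
          have "?C (map x [0..<n]) = {y. \<forall>i<n. y i = x i}"
            by auto
          then show "x \<in> (\<Union>w\<in>{w. ?C w \<subseteq> U}. ?C w)"
            using n by (intro UN_I[of "map x [0..<n]"]) auto
        qed
      qed auto
      also have "\<dots> \<in> sets ?P"
        by (rule sets.countable_UN'[OF countableI_type]) (use cyl in blast)
      finally show ?thesis .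
    qed
    then have "sigma_sets (space ?P) {U. openin cantor_space U} \<subseteq> sets ?P"
      by (intro sets.sigma_sets_subset) auto
    then show "sets (borel_of cantor_space) \<subseteq> sets ?P"
      unfolding borel spaceP .
  next
    have "(\<lambda>x. x i) \<in> measurable (borel_of cantor_space) (count_space UNIV)" for i
    proof (rule measurableI)
      fix B :: "bool set"
      have "openin cantor_space {x \<in> topspace cantor_space. x i \<in> B}"
        unfolding cantor_space_def
        by (rule openin_continuous_map_preimage[where Y = "discrete_topology UNIV"]) (auto intro: continuous_map_product_projection)
      then show "(\<lambda>x. x i) -` B \<inter> space (borel_of cantor_space) \<in> sets (borel_of cantor_space)"
        unfolding borel by (intro sigma_sets.Basic) (simp add: borel_of_def space_measure_of_conv top vimage_def)
    qed auto
    then have "(\<lambda>x. x) \<in> measurable (borel_of cantor_space) ?P"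
      by (intro measurable_PiM_single') auto
    from measurable_sets[OF this] show "sets ?P \<subseteq> sets (borel_of cantor_space)"
      using sets.sets_into_space spaceP
      by (auto simp: borel_of_def space_measure_of_conv top)
  qed
qed

lemma measurable_borel_of_cantor:
  assumes "\<And>k. Measurable.pred M (\<lambda>x. f x k)"
  shows "f \<in> measurable M (borel_of cantor_space)"
proof -
  have "f \<in> measurable M (PiM UNIV (\<lambda>_. count_space UNIV))"
    by (rule measurable_PiM_single') (use assms in auto)
  then show ?thesis
    by (simp cong: measurable_cong_sets add: sets_borel_of_cantor)
qed

lemma measurable_stem:
  assumes [measurable]: "\<And>i. (\<lambda>b. X b i) \<in> measurable M (count_space UNIV)"
  shows "(\<lambda>b. stem (X b) n) \<in> measurable M (count_space UNIV)"
proof (induction n)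
  case 0
  show ?case by simp
next
  case (Suc n)
  note [measurable] = Suc.IH
  have "Measurable.pred M (\<lambda>b. recurs (X b) w)" for w
    unfolding recurs_def occurs_def by measurable
  then have [measurable]: "Measurable.pred M (\<lambda>b. recurs (X b) (stem (X b) n @ [d]))" for d
    by (rule measurable_compose_countable[where g = "\<lambda>b. stem (X b) n" and f = "\<lambda>w b. recurs (X b) (w @ [d])"]) measurable
  show ?case by simp
qed

lemma measurable_tail_code:
  assumes [measurable]: "\<And>i. (\<lambda>b. X b i) \<in> measurable M (count_space UNIV)"
  shows "(\<lambda>b. tail_code (X b) n) \<in> measurable M (count_space UNIV)"
proof -
  note [measurable] = measurable_stem[OF assms]
  have occ [measurable]: "Measurable.pred M (\<lambda>b. occurs (X b) w i)" for w i
    unfolding occurs_def by measurable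
  have [measurable]: "Measurable.pred M (\<lambda>b. occurs (X b) (stem (X b) n) i)" for n i
    by (rule measurable_compose_countable[where g = "\<lambda>b. stem (X b) n" and f = "\<lambda>w b. occurs (X b) w i"]) measurable
  have first [measurable]: "(\<lambda>b. first_occ (X b) n) \<in> measurable M (count_space UNIV)" for n
    unfolding first_occ_def by measurable
  have [measurable]: "(\<lambda>b. stem_limit (X b) l) \<in> measurable M (count_space UNIV)" for l
    unfolding stem_limit_def
    by (rule measurable_compose[OF measurable_stem[OF assms]]) simp
  have "Measurable.pred M (\<lambda>b. \<exists>v. v = X b i \<and> v = stem_limit (X b) j)" for i j
    by measurable
  then have [measurable]: "Measurable.pred M (\<lambda>b. X b i = stem_limit (X b) j)" for i j
    by simp
  have [measurable]: "Measurable.pred M (\<lambda>b. tail_eq (X b) (stem_limit (X b)))"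
    unfolding tail_eq_def by measurable
  have mapX: "(\<lambda>b. map (X b) w) \<in> measurable M (count_space UNIV)" for w
  proof (induction w)
    case (Cons a w)
    note [measurable] = Cons.IH
    have "(\<lambda>b. X b a # map (X b) w) \<in> measurable M (count_space UNIV)" by measurable
    then show ?case by simp
  qed simp
  have "(\<lambda>b. map (X b) [fst c..<snd c]) \<in> measurable M (count_space UNIV)" for c
    by (rule mapX)
  then have [measurable]: "(\<lambda>b. segment (X b) n) \<in> measurable M (count_space UNIV)"
    unfolding segment_def
    using measurable_compose_countable[where g = "\<lambda>b. (first_occ (X b) n, first_occ (X b) (Suc n))" and f = "\<lambda>c b. map (X b) [fst c..<snd c]" and M = M and N = "count_space UNIV"]
    by simp
  show ?thesis
    unfolding tail_code_def by measurable
qed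

lemma measurable_graph_code_tail_code:
  assumes "\<And>i. (\<lambda>b. X b i) \<in> measurable M (count_space UNIV)"
  shows "(\<lambda>b. graph_code (tail_code (X b))) \<in> measurable M (borel_of cantor_space)"
proof (rule measurable_borel_of_cantor)
  note [measurable] = measurable_tail_code[OF assms]
  show "Measurable.pred M (\<lambda>b. graph_code (tail_code (X b)) k)" for k
    unfolding graph_code_def by measurable
qed

section \<open>Eventual equality is not smooth\<close>

text \<open>
The balls of radius \<open>1/(k+1)\<close> about the points of a countable dense set separate points.
\<close>

lemma standard_borel_countably_separated:
  fixes Y :: "'y measure"
  assumes "standard_borel Y"
  shows "\<exists>A :: nat \<Rightarrow> 'y set. (\<forall>i. A i \<in> sets Y) \<and>
    (\<forall>x\<in>space Y. \<forall>y\<in>space Y. (\<forall>i. x \<in> A i \<longleftrightarrow> y \<in> A i) \<longrightarrow> x = y)"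
proof -
  obtain X where X: "completely_metrizable_space X" "separable_space X" "sets Y = sets (borel_of X)"
    using assms by (auto simp: standard_borel_def polish_topology_def)
  have setsY: "U \<in> sets Y" if "openin X U" for U
    unfolding X(3) borel_of_def using that
    by (subst sets_measure_of) (auto dest: openin_subset)
  have spaceY: "space Y = topspace X"
    using sets_eq_imp_space_eq[OF X(3)] by (simp add: borel_of_def space_measure_of_conv)
  obtain S d where Sd: "Metric_space S d" "X = Metric_space.mtopology S d"
    using completely_metrizable_imp_metrizable_space[OF X(1)] unfolding metrizable_space_def by blast
  interpret Metric_space S d by (rule Sd(1))
  obtain C where C: "countable C" "C \<subseteq> topspace X" "X closure_of C = topspace X"
    using X(2) unfolding separable_space_def by blast
  \<comment> \<open>The empty set makes the family nonempty, so that a sequence can enumerate it.\<close>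
  define B where "B = insert {} ((\<lambda>(c, k). mball c (1 / real (Suc k))) ` (C \<times> UNIV))"
  have "countable B" "B \<noteq> {}"
    unfolding B_def using C(1) by auto
  define A where "A = from_nat_into B"
  have A: "range A = B"
    unfolding A_def using \<open>countable B\<close> \<open>B \<noteq> {}\<close> by (simp add: range_from_nat_into)
  have sep: "x = y" if xy: "x \<in> S" "y \<in> S" and same: "\<And>i. x \<in> A i \<longleftrightarrow> y \<in> A i" for x y
  proof (rule ccontr)
    assume "x \<noteq> y"
    then have "d x y / 2 > 0" using xy by simp
    then obtain k where k: "1 / real (Suc k) < d x y / 2"
      by (rule nat_approx_posE)
    have "x \<in> X closure_of C"
      using C(3) xy Sd(2) by simp
    then have "\<forall>r>0. \<exists>c\<in>C. c \<in> mball x r"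
      unfolding Sd(2) metric_closure_of by blast
    moreover have "0 < 1 / real (Suc k)"
      by simp
    ultimately obtain c where c: "c \<in> C" "c \<in> mball x (1 / real (Suc k))"
      by blast
    have "mball c (1 / real (Suc k)) \<in> range A"
      unfolding A B_def using c(1) by auto
    then obtain i where i: "A i = mball c (1 / real (Suc k))"
      by fastforce
    have "x \<in> A i"
      unfolding i using c(2) by (auto simp: commute)
    then have "y \<in> mball c (1 / real (Suc k))"
      using same i by blast
    then have "d x y < 1 / real (Suc k) + 1 / real (Suc k)"
      using c(2) triangle[of x c y] xy by (auto simp: in_mball)
    then show False using k by simp
  qed
  have "A i \<in> sets Y" for i
  proof -
    have "A i \<in> B" using A by auto
    then show ?thesis
      unfolding B_def by (auto intro!: setsY simp: Sd(2))
  qed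
  moreover have "space Y = S" by (simp add: spaceY Sd(2))
  ultimately show ?thesis using sep by (intro exI[of _ A]) blast
qed

definition coin :: "(nat \<Rightarrow> bool) measure" where
  "coin = PiM UNIV (\<lambda>_. measure_pmf (pmf_of_set UNIV))"

interpretation coin_product: product_prob_space "\<lambda>_::nat. measure_pmf (pmf_of_set (UNIV :: bool set))" UNIV
  by unfold_locales

lemma prob_space_coin: "prob_space coin"
  unfolding coin_def by (rule coin_product.P.prob_space_axioms)

interpretation coin: prob_space coin
  by (rule prob_space_coin)

lemma space_coin [simp]: "space coin = UNIV"
  by (simp add: coin_def space_PiM)

lemma sets_coin: "sets coin = sets (borel_of cantor_space)"
  unfolding coin_def sets_borel_of_cantor by (rule sets_PiM_cong) simp_all

lemma indep_coin: "coin.indep_vars (\<lambda>_. count_space UNIV) (\<lambda>i x. x i) UNIV"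
proof -
  have meas: "(\<lambda>x. x i) \<in> measurable coin (count_space UNIV)" for i
    unfolding coin_def by measurable
  have "distr coin (count_space UNIV) (\<lambda>x. x i) = measure_pmf (pmf_of_set UNIV)" for i
  proof -
    have "distr coin (measure_pmf (pmf_of_set UNIV)) (\<lambda>x. x i) = measure_pmf (pmf_of_set UNIV)"
      unfolding coin_def by (rule coin_product.PiM_component) simp
    then show ?thesis
      by (subst (asm) distr_cong[OF HOL.refl _ HOL.refl, of _ "count_space UNIV"]) simp_all
  qed
  moreover have "distr coin (PiM UNIV (\<lambda>_. count_space UNIV)) (\<lambda>x. x) = coin"
    unfolding coin_def by (intro distr_id2 sets_PiM_cong) simp_all
  ultimately show ?thesis
    using meas by (subst coin.indep_vars_iff_distr_eq_PiM') (simp_all add: coin_def restrict_UNIV)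
qed

text \<open>
Overwriting the first \<open>n\<close> coordinates keeps a point in its \<open>E0\<close>-class.  So membership in \<open>A\<close>
depends only on the coordinates from \<open>n\<close> on, for each \<open>n\<close>, and Kolmogorov's law applies.
\<close>

lemma coin_zero_one:
  assumes A: "A \<in> sets coin" and inv: "\<And>x y. E0 x y \<Longrightarrow> x \<in> A \<longleftrightarrow> y \<in> A"
  shows "coin.prob A = 0 \<or> coin.prob A = 1"
proof -
  define F where "F i = sigma_sets UNIV {(\<lambda>x :: nat \<Rightarrow> bool. x i) -` B |B. True}" for i
  have sig: "sigma_algebra (space coin) (F i)" for i
    unfolding F_def by (simp add: sigma_algebra_sigma_sets)
  have indep: "coin.indep_sets F UNIV"
    using indep_coin unfolding coin.indep_vars_def F_def by simp
  have "A \<in> coin.tail_events F"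
    unfolding coin.tail_events_def
  proof
    fix n
    define N where "N = sigma (UNIV :: (nat \<Rightarrow> bool) set) (\<Union> (F ` {n..}))"
    have setsN: "sets N = sigma_sets UNIV (\<Union> (F ` {n..}))"
      unfolding N_def by (subst sets_measure_of) auto
    have spaceN: "space N = UNIV" unfolding N_def by (simp add: space_measure_of_conv)
    \<comment> \<open>The map that overwrites the first \<open>n\<close> coordinates.\<close>
    define \<tau> where "\<tau> x i = (if i < n then False else x i)" for x :: "nat \<Rightarrow> bool" and i
    have "(\<lambda>x. \<tau> x i) \<in> measurable N (count_space UNIV)" for i
    proof (cases "i < n")
      case True
      then show ?thesis by (simp add: \<tau>_def)
    next
      case False
      have "(\<lambda>x. x i) -` B \<in> sets N" for B
      proof -
        have "(\<lambda>x. x i) -` B \<in> F i"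
          unfolding F_def by (intro sigma_sets.Basic) blast
        then show ?thesis
          unfolding setsN using False by (intro sigma_sets.Basic UN_I[of i]) auto
      qed
      then have "(\<lambda>x. x i) \<in> measurable N (count_space UNIV)"
        by (intro measurableI) (auto simp: spaceN)
      then show ?thesis using False by (simp add: \<tau>_def)
    qed
    then have "\<tau> \<in> measurable N coin"
      unfolding coin_def by (intro measurable_PiM_single') auto
    then have "\<tau> -` A \<inter> space N \<in> sets N"
      using A by (rule measurable_sets)
    moreover have "E0 (\<tau> x) x" for x
      unfolding E0_def \<tau>_def by (rule finite_subset[of _ "{..<n}"]) auto
    then have "\<tau> -` A = A" using inv by auto
    ultimately show "A \<in> sigma_sets (space coin) (\<Union> (F ` {n..}))"
      by (simp add: spaceN setsN)
  qed
  then show ?thesis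
    by (rule coin.kolmogorov_0_1_law[OF sig indep])
qed

text \<open>
The first \<open>m + 1\<close> of these coordinates alone agree with \<open>c\<close> only with probability \<open>(1/2)\<^sup>m\<^sup>+\<^sup>1\<close>.
\<close>

lemma coin_agree_null: "AE x in coin. \<not> (\<forall>i\<ge>n. x i = c i)"
proof -
  let ?S = "{x. \<forall>i\<ge>n. x i = c i}"
  have meas: "(\<lambda>x. x i) \<in> measurable coin (count_space UNIV)" for i
    unfolding coin_def by measurable
  have S: "?S \<in> sets coin"
  proof -
    note [measurable] = meas
    have "{x \<in> space coin. \<forall>i\<ge>n. x i = c i} \<in> sets coin" by measurable
    then show ?thesis by simp
  qed
  have half: "coin.prob {x. x i = b} = 1 / 2" for i b
  proof -
    have "emeasure coin {x \<in> space coin. x i \<in> {b}} = emeasure (measure_pmf (pmf_of_set UNIV)) {b}"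
      unfolding coin_def by (rule coin_product.emeasure_PiM_Collect_single) auto
    then have "coin.prob {x \<in> space coin. x i \<in> {b}} = measure_pmf.prob (pmf_of_set UNIV) {b}"
      by (simp add: measure_def)
    then show ?thesis
      by (simp add: measure_pmf_single)
  qed
  have "coin.prob ?S \<le> (1 / 2) ^ Suc m" for m
  proof -
    have "coin.prob ?S \<le> coin.prob (\<Inter>i\<in>{n..n + m}. (\<lambda>x. x i) -` {c i} \<inter> space coin)"
    proof (rule coin.finite_measure_mono)
      show "(\<Inter>i\<in>{n..n + m}. (\<lambda>x. x i) -` {c i} \<inter> space coin) \<in> sets coin"
        by (intro sets.finite_INT measurable_sets[OF meas]) auto
      show "?S \<subseteq> (\<Inter>i\<in>{n..n + m}. (\<lambda>x. x i) -` {c i} \<inter> space coin)"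
        by (intro subsetI INT_I) simp
    qed
    also have "\<dots> = (\<Prod>i\<in>{n..n + m}. coin.prob ((\<lambda>x. x i) -` {c i} \<inter> space coin))"
      by (rule coin.indep_varsD[OF indep_coin]) auto
    also have "\<dots> = (\<Prod>i\<in>{n..n + m}. 1 / 2)"
      by (intro prod.cong HOL.refl) (simp add: half vimage_def)
    finally show ?thesis by simp
  qed
  moreover have "(\<lambda>m. (1 / 2 :: real) ^ Suc m) \<longlonglongrightarrow> 0"
    by (intro LIMSEQ_Suc LIMSEQ_power_zero) simp
  ultimately have "coin.prob ?S \<le> 0"
    using LIMSEQ_le_const[of "\<lambda>m. (1 / 2) ^ Suc m" 0 "coin.prob ?S"] by blast
  then have "emeasure coin ?S = 0"
    using measure_nonneg[of coin ?S] by (simp add: coin.emeasure_eq_measure)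
  then have "?S \<in> null_sets coin"
    using S by (rule null_setsI)
  then show ?thesis
    by (rule AE_I') simp
qed

text \<open>
The preimages of countably many separating sets have probability \<open>0\<close> or \<open>1\<close>, so a
classifying map \<open>\<theta>\<close> is almost surely constant.  But its fibres are \<open>E0\<close>-classes, and these are null.
\<close>

theorem E0_not_smooth: "\<not> smooth_on TYPE('y) cantor_space E0"
proof
  assume "smooth_on TYPE('y) cantor_space E0"
  moreover have top: "topspace cantor_space = UNIV"
    by (simp add: cantor_space_def)
  ultimately obtain Y :: "'y measure" and \<theta> where Y: "standard_borel Y"
    and \<theta>: "\<theta> \<in> measurable (borel_of cantor_space) Y"
    and E: "\<And>x y. E0 x y \<longleftrightarrow> \<theta> x = \<theta> y"
    unfolding smooth_on_def by auto
  have \<theta>': "\<theta> \<in> measurable coin Y"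
    using \<theta> by (simp cong: measurable_cong_sets add: sets_coin)
  obtain A where A: "\<And>i. A i \<in> sets Y"
    and sep: "\<And>x y. x \<in> space Y \<Longrightarrow> y \<in> space Y \<Longrightarrow> (\<And>i::nat. x \<in> A i \<longleftrightarrow> y \<in> A i) \<Longrightarrow> x = y"
    using standard_borel_countably_separated[OF Y] by metis
  have "\<exists>v. AE x in coin. (\<theta> x \<in> A i) = v" for i
  proof -
    let ?B = "\<theta> -` A i \<inter> space coin"
    have B: "?B \<in> sets coin"
      using \<theta>' A by (rule measurable_sets)
    have "coin.prob ?B = 0 \<or> coin.prob ?B = 1"
      using B by (rule coin_zero_one) (use E in auto)
    then show ?thesis
    proof
      assume "coin.prob ?B = 0"
      then have "AE x in coin. x \<notin> ?B"
        using B by (simp add: coin.prob_eq_0)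
      then show ?thesis by (intro exI[of _ False]) auto
    next
      assume "coin.prob ?B = 1"
      then have "AE x in coin. x \<in> ?B"
        using B by (simp add: coin.prob_eq_1)
      then show ?thesis by (intro exI[of _ True]) auto
    qed
  qed
  then obtain v where v: "\<And>i. AE x in coin. (\<theta> x \<in> A i) = v i"
    by metis
  then have ae: "AE x in coin. \<forall>i. (\<theta> x \<in> A i) = v i"
    by (simp add: AE_all_countable)
  have "\<exists>c. \<forall>i. (\<theta> c \<in> A i) = v i"
  proof (rule ccontr)
    assume "\<not> ?thesis"
    then have "AE x in coin. False"
      by (intro eventually_mono[OF ae]) blast
    then show False by simp
  qed
  then obtain c where c: "\<And>i. (\<theta> c \<in> A i) = v i" by blast
  have \<theta>_space: "\<theta> x \<in> space Y" for x
    using measurable_space[OF \<theta>'] by simp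
  have "AE x in coin. \<forall>n. \<not> (\<forall>i\<ge>n. x i = c i)"
    unfolding AE_all_countable using coin_agree_null by blast
  with ae have "AE x in coin. False"
  proof eventually_elim
    case (elim x)
    have "\<theta> x = \<theta> c"
      using elim(1) c by (intro sep \<theta>_space) simp
    then have "finite {i. x i \<noteq> c i}"
      using E by (simp add: E0_def)
    then obtain n where "\<And>i. x i \<noteq> c i \<Longrightarrow> i < n"
      unfolding finite_nat_set_iff_bounded by blast
    then have "\<forall>i\<ge>n. x i = c i"
      by (metis not_le)
    then show False using elim(2) by blast
  qed
  then show False by simp
qed

section \<open>Groups of affine maps of the line\<close>

text \<open>
The ring \<open>\<int>[1/n]\<close> as a set of real numbers.
\<close>

definition nadic :: "nat \<Rightarrow> real set" where
  "nadic n = {of_int m / of_nat n ^ i | m i. True}"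

text \<open>
A homomorphism into the affine group of the line: \<open>g\<close> stands for the map \<open>t \<mapsto> n\<^bsup>ht g\<^esup> t + pt g\<close>.
\<close>

locale affine_representation = group G for G (structure) +
  fixes n :: nat and pt :: "'a \<Rightarrow> real" and ht :: "'a \<Rightarrow> int"
  assumes n_ge_2: "n \<ge> 2"
    and pt_mult: "g \<in> carrier G \<Longrightarrow> h \<in> carrier G \<Longrightarrow> pt (g \<otimes> h) = pt g + real n powi ht g * pt h"
    and ht_mult: "g \<in> carrier G \<Longrightarrow> h \<in> carrier G \<Longrightarrow> ht (g \<otimes> h) = ht g + ht h"
begin

lemma ht_one [simp]: "ht \<one> = 0"
  using ht_mult[of \<one> \<one>] by simp

lemma pt_one [simp]: "pt \<one> = 0"
  using pt_mult[of \<one> \<one>] by simp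

lemma ht_inv: "g \<in> carrier G \<Longrightarrow> ht (inv g) = - ht g"
  using ht_mult[of g "inv g"] by simp

lemma ht_int_pow:
  assumes "g \<in> carrier G"
  shows "ht (g [^] (k :: int)) = k * ht g"
proof (induction k rule: int_induct[of _ 0])
  case (step1 i)
  then show ?case
    using assms by (simp add: int_pow_mult ht_mult ring_distribs)
next
  case (step2 i)
  have "g [^] i = g [^] (i - 1) \<otimes> g"
    using assms int_pow_mult[of g "i - 1" 1] by simp
  then show ?case
    using step2 assms by (simp add: ht_mult ring_distribs)
qed simp

text \<open>
A map with \<open>pt g = 0\<close> fixes the origin, and a map with \<open>ht g = 0\<close> is a translation.  In both cases \<open>pt\<close> is additive on powers.
\<close>

lemma pt_int_pow:
  assumes "g \<in> carrier G" and "pt g = 0 \<or> ht g = 0"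
  shows "pt (g [^] (k :: int)) = k * pt g"
proof (induction k rule: int_induct[of _ 0])
  case (step1 i)
  then show ?case
    using assms by (auto simp: int_pow_mult pt_mult ht_int_pow ring_distribs)
next
  case (step2 i)
  have "g [^] i = g [^] (i - 1) \<otimes> g"
    using assms int_pow_mult[of g "i - 1" 1] by simp
  then show ?case
    using step2 assms by (auto simp: pt_mult ht_int_pow ring_distribs)
qed simp

end

text \<open>
The homomorphism is an isomorphism onto the semidirect product of \<open>\<int>[1/n]\<close> and \<open>\<int>\<close>.
\<close>

locale affine_coordinates = affine_representation +
  assumes coords_bij: "bij_betw (\<lambda>g. (pt g, ht g)) (carrier G) (nadic n \<times> UNIV)"

context group
begin

lemma int_pow_Suc:
  assumes "x \<in> carrier G"
  shows "x [^] (k + 1 :: int) = x [^] k \<otimes> x" "x [^] (k + 1 :: int) = x \<otimes> x [^] k"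
    "x [^] k = x [^] (k - 1 :: int) \<otimes> x"
  using assms int_pow_mult[of x k 1] int_pow_mult[of x 1 k] int_pow_mult[of x "k - 1" 1]
  by (simp_all add: add.commute)

context
  fixes \<alpha> \<beta> :: 'a and n :: nat
  assumes \<alpha>: "\<alpha> \<in> carrier G" and \<beta>: "\<beta> \<in> carrier G" and rel: "\<beta> \<otimes> \<alpha> \<otimes> inv \<beta> = \<alpha> [^] n"
begin

lemma bs_conj: "\<beta> \<otimes> \<alpha> [^] m = \<alpha> [^] (int n * m) \<otimes> \<beta>" for m :: int
proof -
  have step: "\<beta> \<otimes> \<alpha> = \<alpha> [^] int n \<otimes> \<beta>"
    using rel inv_solve_right'[of "\<alpha> [^] n" "\<beta> \<otimes> \<alpha>" \<beta>] \<alpha> \<beta> by (simp add: int_pow_int)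
  show ?thesis
  proof (induction m rule: int_induct[of _ 0])
    case base
    show ?case using \<beta> by simp
  next
    case (step1 i)
    have "\<beta> \<otimes> \<alpha> [^] (i + 1) = (\<beta> \<otimes> \<alpha> [^] i) \<otimes> \<alpha>"
      using \<alpha> \<beta> by (simp add: int_pow_Suc(1) m_assoc)
    also have "\<dots> = \<alpha> [^] (int n * i) \<otimes> (\<beta> \<otimes> \<alpha>)"
      using \<alpha> \<beta> step1 by (simp add: m_assoc)
    also have "\<dots> = (\<alpha> [^] (int n * i) \<otimes> \<alpha> [^] int n) \<otimes> \<beta>"
      unfolding step using \<alpha> \<beta> by (simp add: m_assoc)
    also have "\<dots> = \<alpha> [^] (int n * (i + 1)) \<otimes> \<beta>"
      using \<alpha> by (simp add: int_pow_mult[symmetric] ring_distribs)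
    finally show ?case .
  next
    case (step2 i)
    have "(\<beta> \<otimes> \<alpha> [^] (i - 1)) \<otimes> \<alpha> = \<beta> \<otimes> \<alpha> [^] i"
      using \<alpha> \<beta> int_pow_Suc(3)[of \<alpha> i] by (simp add: m_assoc)
    also have "\<dots> = \<alpha> [^] (int n * i) \<otimes> \<beta>"
      by (rule step2)
    also have "\<dots> = \<alpha> [^] (int n * (i - 1)) \<otimes> \<alpha> [^] int n \<otimes> \<beta>"
      using \<alpha> by (simp add: int_pow_mult[symmetric] right_diff_distrib)
    also have "\<dots> = (\<alpha> [^] (int n * (i - 1)) \<otimes> \<beta>) \<otimes> \<alpha>"
      using \<alpha> \<beta> step by (simp add: m_assoc)
    finally show ?case
      using \<alpha> \<beta> by (meson int_pow_closed m_closed right_cancel)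
  qed
qed

lemma bs_conj_pow: "\<alpha> [^] c \<otimes> inv (\<beta> [^] i) = inv (\<beta> [^] i) \<otimes> \<alpha> [^] (int n ^ i * c)"
  for i :: nat and c :: int
proof (induction i arbitrary: c)
  case 0
  show ?case using \<alpha> by simp
next
  case (Suc i)
  have *: "\<alpha> [^] c \<otimes> inv \<beta> = inv \<beta> \<otimes> \<alpha> [^] (int n * c)" for c :: int
  proof -
    have "\<beta> \<otimes> (\<alpha> [^] c \<otimes> inv \<beta>) = \<alpha> [^] (int n * c)"
      using bs_conj[of c] \<alpha> \<beta> by (simp add: m_assoc[symmetric]) (simp add: m_assoc)
    then show ?thesis
      using \<alpha> \<beta> by (metis int_pow_closed inv_closed inv_solve_left m_closed)
  qed
  have inv: "inv (\<beta> [^] Suc i) = inv \<beta> \<otimes> inv (\<beta> [^] i)"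
    using \<beta> by (simp add: inv_mult_group)
  have "\<alpha> [^] c \<otimes> inv (\<beta> [^] Suc i) = (\<alpha> [^] c \<otimes> inv \<beta>) \<otimes> inv (\<beta> [^] i)"
    unfolding inv using \<alpha> \<beta> by (simp add: m_assoc)
  also have "\<dots> = inv \<beta> \<otimes> (\<alpha> [^] (int n * c) \<otimes> inv (\<beta> [^] i))"
    unfolding * using \<alpha> \<beta> by (simp add: m_assoc)
  also have "\<dots> = inv (\<beta> [^] Suc i) \<otimes> \<alpha> [^] (int n ^ i * (int n * c))"
    unfolding Suc.IH inv using \<alpha> \<beta> by (simp add: m_assoc)
  finally show ?case
    by (simp add: ac_simps)
qed

text \<open>
In the affine group this element is \<open>t \<mapsto> (n\<^sup>k t + m) / n\<^sup>i\<close>, so each map has such a form.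
\<close>

definition bs_normal_forms :: "'a set" where
  "bs_normal_forms =
    {inv (\<beta> [^] i) \<otimes> \<alpha> [^] m \<otimes> \<beta> [^] k | (i::nat) (m::int) (k::int). True}"

text \<open>
These closure properties make every product of the generators and their inverses a normal form.  A letter \<open>\<beta>\<close> in
front is absorbed after raising the exponent \<open>i\<close> by one, and a power of \<open>\<alpha>\<close> passes \<open>\<beta>\<^sup>-\<^sup>i\<close> by
\<open>bs_conj_pow\<close>.
\<close>

lemma bs_normal_forms_closed:
  assumes "g \<in> bs_normal_forms"
  shows "\<beta> \<otimes> g \<in> bs_normal_forms" "inv \<beta> \<otimes> g \<in> bs_normal_forms"
    "\<alpha> [^] (c::int) \<otimes> g \<in> bs_normal_forms"
proof -
  obtain i :: nat and m k :: int where g: "g = inv (\<beta> [^] i) \<otimes> \<alpha> [^] m \<otimes> \<beta> [^] k"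
    using assms unfolding bs_normal_forms_def by blast
  have inv: "inv (\<beta> [^] Suc i) = inv \<beta> \<otimes> inv (\<beta> [^] i)"
    using \<beta> by (simp add: inv_mult_group)
  have inv': "inv (\<beta> [^] Suc i) = inv (\<beta> [^] i) \<otimes> inv \<beta>"
    unfolding nat_pow_Suc2[OF \<beta>] using \<beta> by (simp add: inv_mult_group)
  have "inv \<beta> \<otimes> g = inv (\<beta> [^] Suc i) \<otimes> \<alpha> [^] m \<otimes> \<beta> [^] k"
    unfolding g inv using \<alpha> \<beta> by (simp add: m_assoc)
  then show "inv \<beta> \<otimes> g \<in> bs_normal_forms"
    unfolding bs_normal_forms_def by blast
  have "g = inv (\<beta> [^] i) \<otimes> (inv \<beta> \<otimes> (\<beta> \<otimes> \<alpha> [^] m)) \<otimes> \<beta> [^] k"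
    unfolding g using \<alpha> \<beta> by (simp add: m_assoc[symmetric])
  also have "\<dots> = inv (\<beta> [^] Suc i) \<otimes> \<alpha> [^] (int n * m) \<otimes> \<beta> [^] (k + 1)"
    unfolding bs_conj inv' using \<alpha> \<beta> by (simp add: m_assoc int_pow_Suc(2))
  finally have "\<beta> \<otimes> g = \<beta> \<otimes> (inv \<beta> \<otimes> (inv (\<beta> [^] i) \<otimes> (\<alpha> [^] (int n * m) \<otimes> \<beta> [^] (k + 1))))"
    unfolding inv using \<alpha> \<beta> by (simp add: m_assoc)
  also have "\<dots> = inv (\<beta> [^] i) \<otimes> \<alpha> [^] (int n * m) \<otimes> \<beta> [^] (k + 1)"
    using \<alpha> \<beta> by (simp add: m_assoc[symmetric])
  finally show "\<beta> \<otimes> g \<in> bs_normal_forms"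
    unfolding bs_normal_forms_def by blast
  have "\<alpha> [^] c \<otimes> g = inv (\<beta> [^] i) \<otimes> (\<alpha> [^] (int n ^ i * c) \<otimes> \<alpha> [^] m) \<otimes> \<beta> [^] k"
    unfolding g using \<alpha> \<beta> bs_conj_pow[of c i] by (simp add: m_assoc[symmetric])
  then have "\<alpha> [^] c \<otimes> g = inv (\<beta> [^] i) \<otimes> \<alpha> [^] (int n ^ i * c + m) \<otimes> \<beta> [^] k"
    using \<alpha> by (simp add: int_pow_mult)
  then show "\<alpha> [^] c \<otimes> g \<in> bs_normal_forms"
    unfolding bs_normal_forms_def by blast
qed

lemma one_bs_normal_forms: "\<one> \<in> bs_normal_forms"
  unfolding bs_normal_forms_def by (intro CollectI exI[of _ "0::nat"] exI[of _ "0::int"]) simp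

end

end

section \<open>Affine coordinates on the Baumslag--Solitar groups\<close>

context
  fixes n :: nat
  assumes n: "n \<ge> 2"
begin

fun affine_mult :: "real \<times> int \<Rightarrow> real \<times> int \<Rightarrow> real \<times> int" where
  "affine_mult (x, k) (y, l) = (x + real n powi k * y, k + l)"

fun affine_letter :: "bs_gen \<times> bool \<Rightarrow> real \<times> int" where
  "affine_letter (gen_a, s) = (if s then 1 else - 1, 0)"
| "affine_letter (gen_b, s) = (0, if s then 1 else - 1)"

definition affine_word :: "bs_gen gword \<Rightarrow> real \<times> int" where
  "affine_word w = foldr (\<lambda>c. affine_mult (affine_letter c)) w (0, 0)"

lemma affine_mult_assoc: "affine_mult (affine_mult p q) r = affine_mult p (affine_mult q r)"
proof -
  have "real n powi (k + l) = real n powi k * real n powi l" for k l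
    using n by (intro power_int_add) simp
  then show ?thesis
    by (cases p; cases q; cases r) (simp add: distrib_left mult.assoc)
qed

lemma affine_word_Nil: "affine_word [] = (0, 0)"
  and affine_word_Cons: "affine_word (c # w) = affine_mult (affine_letter c) (affine_word w)"
  by (simp_all add: affine_word_def)

lemma affine_word_append: "affine_word (u @ v) = affine_mult (affine_word u) (affine_word v)"
proof (induction u)
  case Nil
  show ?case by (cases "affine_word v") (simp add: affine_word_Nil)
qed (simp add: affine_word_Cons affine_mult_assoc)

definition bs_rel :: "(bs_gen gword \<times> bs_gen gword) set" where
  "bs_rel = {([(gen_b, True), (gen_a, True), (gen_b, False)], replicate n (gen_a, True))}"

text \<open>
The defining relation holds for the translation by \<open>1\<close> and the multiplication by \<open>n\<close>.
\<close>

lemma affine_word_cong: "pres_eq bs_rel u v \<Longrightarrow> affine_word u = affine_word v"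
proof (induction rule: pres_eq.induct)
  case (cancel x b)
  show ?case
    using n by (cases x; cases b) (simp_all add: affine_word_Cons affine_word_Nil)
next
  case (relation u v)
  have "affine_word (replicate m (gen_a, True)) = (real m, 0)" for m
    by (induction m) (simp_all add: affine_word_Cons affine_word_Nil)
  then show ?case
    using relation by (simp add: bs_rel_def affine_word_Cons affine_word_Nil)
qed (simp_all add: affine_word_append)

definition bs_coords :: "bs_gen gword set \<Rightarrow> real \<times> int" where
  "bs_coords U = affine_word (SOME w. w \<in> U)"

lemma bs_coords_class: "bs_coords (pres_class bs_rel w) = affine_word w"
proof -
  have "(SOME w'. w' \<in> pres_class bs_rel w) \<in> pres_class bs_rel w"
    by (rule someI[of _ w]) (simp add: pres_class_def pres_eq.refl)
  then have "pres_eq bs_rel w (SOME w'. w' \<in> pres_class bs_rel w)"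
    by (simp add: pres_class_def)
  then show ?thesis
    unfolding bs_coords_def by (metis affine_word_cong)
qed

lemma group_BS1: "group (BS1 n)"
  unfolding BS1_def by (rule group_presented_group)

lemma BS1_presented: "BS1 n = presented_group bs_rel"
  by (simp add: BS1_def bs_rel_def)

lemma carrier_BS1: "carrier (BS1 n) = range (pres_class bs_rel)"
  by (simp add: BS1_presented presented_group_def)

lemma mult_BS1: "pres_class bs_rel u \<otimes>\<^bsub>BS1 n\<^esub> pres_class bs_rel v = pres_class bs_rel (u @ v)"
  unfolding BS1_presented by (rule presented_group_mult)

lemma one_BS1: "\<one>\<^bsub>BS1 n\<^esub> = pres_class bs_rel []"
  by (simp add: BS1_presented presented_group_def)

lemma affine_representation_BS1:
  "affine_representation (BS1 n) n (fst \<circ> bs_coords) (snd \<circ> bs_coords)"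
proof (intro affine_representation.intro group_BS1 affine_representation_axioms.intro n)
  fix g h assume "g \<in> carrier (BS1 n)" "h \<in> carrier (BS1 n)"
  then obtain u v where uv: "g = pres_class bs_rel u" "h = pres_class bs_rel v"
    by (auto simp: carrier_BS1)
  then have *: "bs_coords (g \<otimes>\<^bsub>BS1 n\<^esub> h) = affine_mult (bs_coords g) (bs_coords h)"
    by (simp add: mult_BS1 bs_coords_class affine_word_append)
  show "(fst \<circ> bs_coords) (g \<otimes>\<^bsub>BS1 n\<^esub> h) =
      (fst \<circ> bs_coords) g + real n powi (snd \<circ> bs_coords) g * (fst \<circ> bs_coords) h"
    unfolding comp_def * by (cases "bs_coords g"; cases "bs_coords h") simp
  show "(snd \<circ> bs_coords) (g \<otimes>\<^bsub>BS1 n\<^esub> h) = (snd \<circ> bs_coords) g + (snd \<circ> bs_coords) h"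
    unfolding comp_def * by (cases "bs_coords g"; cases "bs_coords h") simp
qed

interpretation bs: affine_representation "BS1 n" n "fst \<circ> bs_coords" "snd \<circ> bs_coords"
  by (rule affine_representation_BS1)

abbreviation bs_a where "bs_a \<equiv> pres_class bs_rel [(gen_a, True)]"
abbreviation bs_b where "bs_b \<equiv> pres_class bs_rel [(gen_b, True)]"

lemma bs_generators: "bs_a \<in> carrier (BS1 n)" "bs_b \<in> carrier (BS1 n)"
  by (simp_all add: carrier_BS1)

lemma bs_inverse_letter:
  "inv\<^bsub>BS1 n\<^esub> (pres_class bs_rel [(x, True)]) = pres_class bs_rel [(x, False)]"
proof (rule bs.inv_equality)
  show "pres_class bs_rel [(x, False)] \<otimes>\<^bsub>BS1 n\<^esub> pres_class bs_rel [(x, True)] = \<one>\<^bsub>BS1 n\<^esub>"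
    unfolding mult_BS1 one_BS1 pres_class_eq_iff
    using pres_eq.cancel[of bs_rel x False] by simp
qed (unfold carrier_BS1, (rule rangeI)+)

lemma bs_relation: "bs_b \<otimes>\<^bsub>BS1 n\<^esub> bs_a \<otimes>\<^bsub>BS1 n\<^esub> inv\<^bsub>BS1 n\<^esub> bs_b = bs_a [^]\<^bsub>BS1 n\<^esub> n"
proof -
  have pow: "bs_a [^]\<^bsub>BS1 n\<^esub> m = pres_class bs_rel (replicate m (gen_a, True))" for m :: nat
  proof (induction m)
    case 0
    show ?case unfolding bs.nat_pow_0 one_BS1 by simp
  next
    case (Suc m)
    show ?case
      unfolding bs.nat_pow_Suc Suc.IH mult_BS1 replicate_append_same by simp
  qed
  show ?thesis
    unfolding pow bs_inverse_letter mult_BS1 pres_class_eq_iff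
    by (rule pres_eq.relation) (simp add: bs_rel_def)
qed

lemma bs_normal_form:
  assumes "g \<in> carrier (BS1 n)"
  shows "g \<in> bs.bs_normal_forms bs_a bs_b"
proof -
  note nf = bs.bs_normal_forms_closed[OF bs_generators bs_relation]
  obtain w where "g = pres_class bs_rel w"
    using assms unfolding carrier_BS1 by blast
  moreover have "pres_class bs_rel w \<in> bs.bs_normal_forms bs_a bs_b"
  proof (induction w)
    case Nil
    show ?case
      using bs.one_bs_normal_forms[OF bs_generators bs_relation] by (simp add: one_BS1)
  next
    case (Cons c w)
    obtain x s where c: "c = (x, s)" by fastforce
    have split: "pres_class bs_rel (c # w) = pres_class bs_rel [c] \<otimes>\<^bsub>BS1 n\<^esub> pres_class bs_rel w"
      by (simp add: mult_BS1)
    have "inv\<^bsub>BS1 n\<^esub> bs_a = bs_a [^]\<^bsub>BS1 n\<^esub> (- 1 :: int)"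
      using bs.int_pow_neg[OF bs_generators(1), of 1] bs_generators(1) by simp
    then show ?case
      unfolding split unfolding c
      using nf(1,2)[OF Cons.IH] nf(3)[OF Cons.IH, of 1] nf(3)[OF Cons.IH, of "- 1"] bs_generators
      by (cases x; cases s) (simp_all flip: bs_inverse_letter)
  qed
  ultimately show ?thesis by simp
qed

lemma bs_coords_normal_form:
  fixes i :: nat and m k :: int
  shows "bs_coords (inv\<^bsub>BS1 n\<^esub> (bs_b [^]\<^bsub>BS1 n\<^esub> i) \<otimes>\<^bsub>BS1 n\<^esub> bs_a [^]\<^bsub>BS1 n\<^esub> m \<otimes>\<^bsub>BS1 n\<^esub> bs_b [^]\<^bsub>BS1 n\<^esub> k)
    = (of_int m / of_nat n ^ i, k - int i)"
proof -
  have a: "fst (bs_coords bs_a) = 1" "snd (bs_coords bs_a) = 0"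
    and b: "fst (bs_coords bs_b) = 0" "snd (bs_coords bs_b) = 1"
    by (simp_all add: bs_coords_class affine_word_Cons affine_word_Nil)
  have inv: "inv\<^bsub>BS1 n\<^esub> (bs_b [^]\<^bsub>BS1 n\<^esub> i) = bs_b [^]\<^bsub>BS1 n\<^esub> (- int i)"
    using bs_generators by (simp add: bs.int_pow_neg_int)
  show ?thesis
    unfolding inv
    using a b bs_generators bs.pt_int_pow[OF bs_generators(1), of m] bs.ht_int_pow[OF bs_generators(1), of m]
      bs.pt_int_pow[OF bs_generators(2), of k] bs.ht_int_pow[OF bs_generators(2), of k]
      bs.pt_int_pow[OF bs_generators(2), of "- int i"] bs.ht_int_pow[OF bs_generators(2), of "- int i"]
      bs.pt_mult[unfolded comp_def] bs.ht_mult[unfolded comp_def]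
    by (intro prod_eqI) (simp_all add: power_int_minus divide_inverse)
qed

text \<open>
For injectivity it suffices to look at the kernel: a normal form \<open>b\<^sup>-\<^sup>i a\<^sup>m b\<^sup>k\<close> has coordinates \<open>(m/n\<^sup>i, k - i)\<close>, and if
both vanish, then \<open>m = 0\<close> and \<open>k = i\<close>, so the element is trivial.
\<close>

theorem affine_coordinates_BS1:
  "affine_coordinates (BS1 n) n (fst \<circ> bs_coords) (snd \<circ> bs_coords)"
proof (intro affine_coordinates.intro affine_representation_BS1 affine_coordinates_axioms.intro)
  have nf: "\<exists>(i::nat) (m::int) (k::int). g = inv\<^bsub>BS1 n\<^esub> (bs_b [^]\<^bsub>BS1 n\<^esub> i) \<otimes>\<^bsub>BS1 n\<^esub>
      bs_a [^]\<^bsub>BS1 n\<^esub> m \<otimes>\<^bsub>BS1 n\<^esub> bs_b [^]\<^bsub>BS1 n\<^esub> k" if "g \<in> carrier (BS1 n)" for g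
    using bs_normal_form[OF that] unfolding bs.bs_normal_forms_def[OF bs_generators bs_relation] by blast
  have kernel: "g = \<one>\<^bsub>BS1 n\<^esub>" if g: "g \<in> carrier (BS1 n)" and zero: "bs_coords g = (0, 0)" for g
  proof -
    obtain i :: nat and m k :: int where *: "g = inv\<^bsub>BS1 n\<^esub> (bs_b [^]\<^bsub>BS1 n\<^esub> i) \<otimes>\<^bsub>BS1 n\<^esub>
      bs_a [^]\<^bsub>BS1 n\<^esub> m \<otimes>\<^bsub>BS1 n\<^esub> bs_b [^]\<^bsub>BS1 n\<^esub> k"
      using nf[OF g] by blast
    then have "m = 0" "k = int i"
      using zero n by (simp_all add: bs_coords_normal_form)
    then show ?thesis
      unfolding * using bs_generators by (simp add: int_pow_int)
  qed
  show "bij_betw (\<lambda>g. ((fst \<circ> bs_coords) g, (snd \<circ> bs_coords) g)) (carrier (BS1 n)) (nadic n \<times> UNIV)"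
    unfolding bij_betw_def
  proof
    show "inj_on (\<lambda>g. ((fst \<circ> bs_coords) g, (snd \<circ> bs_coords) g)) (carrier (BS1 n))"
    proof (rule inj_onI)
      fix g h assume gh: "g \<in> carrier (BS1 n)" "h \<in> carrier (BS1 n)"
        "((fst \<circ> bs_coords) g, (snd \<circ> bs_coords) g) = ((fst \<circ> bs_coords) h, (snd \<circ> bs_coords) h)"
      have "(fst \<circ> bs_coords) (h \<otimes>\<^bsub>BS1 n\<^esub> inv\<^bsub>BS1 n\<^esub> h) = 0"
        using gh bs.pt_one by (simp del: comp_apply)
      then have "bs_coords (g \<otimes>\<^bsub>BS1 n\<^esub> inv\<^bsub>BS1 n\<^esub> h) = (0, 0)"
        using gh bs.pt_mult[of g "inv\<^bsub>BS1 n\<^esub> h"] bs.ht_mult[of g "inv\<^bsub>BS1 n\<^esub> h"]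
          bs.pt_mult[of h "inv\<^bsub>BS1 n\<^esub> h"] bs.ht_inv[of h]
        by (intro prod_eqI) simp_all
      then have "g \<otimes>\<^bsub>BS1 n\<^esub> inv\<^bsub>BS1 n\<^esub> h = \<one>\<^bsub>BS1 n\<^esub>"
        using gh by (intro kernel) simp_all
      then show "g = h"
        using gh bs.inv_equality[of g "inv\<^bsub>BS1 n\<^esub> h"] by simp
    qed
    show "(\<lambda>g. ((fst \<circ> bs_coords) g, (snd \<circ> bs_coords) g)) ` carrier (BS1 n) = nadic n \<times> UNIV"
    proof
      show "(\<lambda>g. ((fst \<circ> bs_coords) g, (snd \<circ> bs_coords) g)) ` carrier (BS1 n) \<subseteq> nadic n \<times> UNIV"
        using nf bs_coords_normal_form by (fastforce simp: nadic_def)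
      show "nadic n \<times> UNIV \<subseteq> (\<lambda>g. ((fst \<circ> bs_coords) g, (snd \<circ> bs_coords) g)) ` carrier (BS1 n)"
      proof
        fix p :: "real \<times> int" assume "p \<in> nadic n \<times> UNIV"
        then obtain m i k where p: "p = (of_int m / of_nat n ^ i, k)"
          unfolding nadic_def by blast
        let ?g = "inv\<^bsub>BS1 n\<^esub> (bs_b [^]\<^bsub>BS1 n\<^esub> i) \<otimes>\<^bsub>BS1 n\<^esub>
          bs_a [^]\<^bsub>BS1 n\<^esub> m \<otimes>\<^bsub>BS1 n\<^esub> bs_b [^]\<^bsub>BS1 n\<^esub> (k + int i)"
        have "bs_coords ?g = p"
          unfolding bs_coords_normal_form p by simp
        then show "p \<in> (\<lambda>g. ((fst \<circ> bs_coords) g, (snd \<circ> bs_coords) g)) ` carrier (BS1 n)"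
          using bs_generators by (intro image_eqI[of _ _ ?g]) auto
      qed
    qed
  qed
qed

end

section \<open>Positive cones and conjugation\<close>

context group
begin

lemma inv_cancel:
  assumes "g \<in> carrier G" "h \<in> carrier G"
  shows "inv g \<otimes> (g \<otimes> h) = h" "g \<otimes> (inv g \<otimes> h) = h"
  using assms by (simp_all add: m_assoc[symmetric])

lemma set_inv_iff:
  assumes "P \<subseteq> carrier G"
  shows "set_inv P = {g \<in> carrier G. inv g \<in> P}"
proof
  show "set_inv P \<subseteq> {g \<in> carrier G. inv g \<in> P}"
    using assms by (auto simp: SET_INV_def)
  show "{g \<in> carrier G. inv g \<in> P} \<subseteq> set_inv P"
  proof
    fix g assume "g \<in> {g \<in> carrier G. inv g \<in> P}"
    then have "inv (inv g) \<in> set_inv P" "g \<in> carrier G" unfolding SET_INV_def by blast+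
    then show "g \<in> set_inv P" by simp
  qed
qed

lemma positive_cone_iff:
  "positive_cone G P \<longleftrightarrow> P \<subseteq> carrier G \<and> (\<forall>g\<in>P. \<forall>h\<in>P. g \<otimes> h \<in> P) \<and> \<one> \<notin> P \<and>
    (\<forall>g\<in>carrier G. g \<noteq> \<one> \<longrightarrow> (inv g \<in> P \<longleftrightarrow> g \<notin> P))"
proof (cases "P \<subseteq> carrier G")
  case True
  have mult: "P <#> P \<subseteq> P \<longleftrightarrow> (\<forall>g\<in>P. \<forall>h\<in>P. g \<otimes> h \<in> P)"
    unfolding set_mult_def by blast
  let ?N = "{g \<in> carrier G. inv g \<in> P}"
  have one: "\<one> \<in> ?N \<longleftrightarrow> \<one> \<in> P"
    by simp
  have "P \<inter> ?N = {} \<and> P \<union> ?N = carrier G - {\<one>} \<longleftrightarrow>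
      \<one> \<notin> P \<and> (\<forall>g\<in>carrier G. g \<noteq> \<one> \<longrightarrow> (inv g \<in> P \<longleftrightarrow> g \<notin> P))" (is "?L \<longleftrightarrow> ?R")
  proof
    assume ?L
    then show ?R by auto
  next
    assume R: ?R
    have "g \<in> P \<union> ?N \<longleftrightarrow> g \<in> carrier G - {\<one>}" for g
      using R True one by (cases "g = \<one>") auto
    moreover have "g \<notin> ?N" if "g \<in> P" for g
      using R that by auto
    ultimately show ?L by auto
  qed
  then show ?thesis
    unfolding positive_cone_def set_inv_iff[OF True] mult using True by argo
qed (simp add: positive_cone_def)

lemma LO_D:
  assumes "P \<in> LO G"
  shows "P \<subseteq> carrier G" and "g \<in> P \<Longrightarrow> g \<in> carrier G"
    and "g \<in> P \<Longrightarrow> h \<in> P \<Longrightarrow> g \<otimes> h \<in> P" and "\<one> \<notin> P"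
    and "g \<in> carrier G \<Longrightarrow> g \<noteq> \<one> \<Longrightarrow> inv g \<in> P \<longleftrightarrow> g \<notin> P"
proof -
  have P: "P \<subseteq> carrier G \<and> (\<forall>g\<in>P. \<forall>h\<in>P. g \<otimes> h \<in> P) \<and> \<one> \<notin> P \<and>
    (\<forall>g\<in>carrier G. g \<noteq> \<one> \<longrightarrow> (inv g \<in> P \<longleftrightarrow> g \<notin> P))"
    using assms unfolding LO_def mem_Collect_eq positive_cone_iff .
  then show "P \<subseteq> carrier G" "\<one> \<notin> P" by simp_all
  show "g \<in> P \<Longrightarrow> g \<in> carrier G" using P by (simp add: subset_iff)
  show "g \<in> P \<Longrightarrow> h \<in> P \<Longrightarrow> g \<otimes> h \<in> P" using P by simp
  show "g \<in> carrier G \<Longrightarrow> g \<noteq> \<one> \<Longrightarrow> inv g \<in> P \<longleftrightarrow> g \<notin> P" using P by simp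
qed

text \<open>
If \<open>g\<close> is not positive, then \<open>g\<close> is trivial or its inverse is positive, and the same holds for all its powers.
\<close>

lemma LO_pow:
  assumes P: "P \<in> LO G" and g: "g \<in> carrier G" and k: "k > (0::nat)"
  shows "g [^] k \<in> P \<longleftrightarrow> g \<in> P"
proof -
  have pow: "h [^] k \<in> P" if "h \<in> P" for h
    using k
  proof (induction k rule: nat_induct_non_zero)
    case 1
    show ?case using that LO_D(2)[OF P that] by simp
  next
    case (Suc k)
    then show ?case using LO_D(3)[OF P _ that] by simp
  qed
  show ?thesis
  proof
    assume gk: "g [^] k \<in> P"
    show "g \<in> P"
    proof (rule ccontr)
      assume "g \<notin> P"
      moreover have "g \<noteq> \<one>" using gk LO_D(4)[OF P] by auto
      ultimately have "inv g \<in> P" using LO_D(5)[OF P g] by blast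
      then have "inv g [^] k \<in> P" by (rule pow)
      then have "inv (g [^] k) \<in> P" using g by (simp add: nat_pow_inv)
      moreover have "g [^] k \<noteq> \<one>" using gk LO_D(4)[OF P] by auto
      ultimately show False using LO_D(5)[OF P, of "g [^] k"] gk g by simp
    qed
  qed (rule pow)
qed

lemma LO_set_inv:
  assumes P: "P \<in> LO G"
  shows "set_inv P \<in> LO G"
proof -
  have "g \<otimes> h \<in> set_inv P" if "g \<in> set_inv P" "h \<in> set_inv P" for g h
    using that LO_D(3)[OF P] by (auto simp: set_inv_iff[OF LO_D(1)[OF P]] inv_mult_group)
  then show ?thesis
    unfolding LO_def mem_Collect_eq positive_cone_iff
    using LO_D(4,5)[OF P] by (auto simp: set_inv_iff[OF LO_D(1)[OF P]])
qed

lemma conj_action_eq: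
  assumes "P \<subseteq> carrier G" "g \<in> carrier G"
  shows "conj_action G g P = {h \<in> carrier G. inv g \<otimes> h \<otimes> g \<in> P}"
proof
  have conj: "conj_action G g P = {g \<otimes> h \<otimes> inv g |h. h \<in> P}"
    unfolding conj_action_def l_coset_def r_coset_def by blast
  have cancel: "inv g \<otimes> (g \<otimes> h \<otimes> inv g) \<otimes> g = h" if "h \<in> carrier G" for h
    using that assms(2) by (simp add: m_assoc inv_cancel)
  have cancel': "g \<otimes> (inv g \<otimes> h \<otimes> g) \<otimes> inv g = h" if "h \<in> carrier G" for h
    using that assms(2) by (simp add: m_assoc inv_cancel)
  show "conj_action G g P \<subseteq> {h \<in> carrier G. inv g \<otimes> h \<otimes> g \<in> P}"
    unfolding conj using assms cancel by (auto simp: subset_iff)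
  show "{h \<in> carrier G. inv g \<otimes> h \<otimes> g \<in> P} \<subseteq> conj_action G g P"
  proof
    fix h assume "h \<in> {h \<in> carrier G. inv g \<otimes> h \<otimes> g \<in> P}"
    then have h: "h \<in> carrier G" "inv g \<otimes> h \<otimes> g \<in> P" by blast+
    show "h \<in> conj_action G g P"
      unfolding conj mem_Collect_eq
      by (intro exI[of _ "inv g \<otimes> h \<otimes> g"] conjI h(2)) (simp add: cancel'[OF h(1)])
  qed
qed

lemma conj_inv:
  assumes "g \<in> carrier G" "h \<in> carrier G"
  shows "inv g \<otimes> inv h \<otimes> g = inv (inv g \<otimes> h \<otimes> g)"
  using assms by (simp add: inv_mult_group m_assoc)

lemma LO_conj_action:
  assumes P: "P \<in> LO G" and g: "g \<in> carrier G"
  shows "conj_action G g P \<in> LO G"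
proof -
  note conj = conj_action_eq[OF LO_D(1)[OF P] g]
  have mult: "inv g \<otimes> (h \<otimes> k) \<otimes> g = (inv g \<otimes> h \<otimes> g) \<otimes> (inv g \<otimes> k \<otimes> g)"
    if "h \<in> carrier G" "k \<in> carrier G" for h k
    using that g by (simp add: m_assoc inv_cancel)
  have one: "inv g \<otimes> h \<otimes> g \<noteq> \<one>" if "h \<in> carrier G" "h \<noteq> \<one>" for h
  proof
    assume "inv g \<otimes> h \<otimes> g = \<one>"
    then have "inv g \<otimes> h = inv g"
      using that g by (metis inv_closed inv_equality inv_inv m_closed)
    then show False
      using that g by (metis inv_closed l_cancel_one)
  qed
  have "h \<otimes> k \<in> conj_action G g P" if "h \<in> conj_action G g P" "k \<in> conj_action G g P" for h k
    using that LO_D(3)[OF P] unfolding conj by (auto simp: mult)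
  moreover have "\<one> \<notin> conj_action G g P"
    unfolding conj using g LO_D(4)[OF P] by simp
  moreover have "inv h \<in> conj_action G g P \<longleftrightarrow> h \<notin> conj_action G g P"
    if "h \<in> carrier G" "h \<noteq> \<one>" for h
    unfolding conj using that g LO_D(5)[OF P, of "inv g \<otimes> h \<otimes> g"] one by (simp add: conj_inv)
  moreover have "conj_action G g P \<subseteq> carrier G"
    unfolding conj by blast
  ultimately show ?thesis
    unfolding LO_def mem_Collect_eq positive_cone_iff by simp
qed

lemma conj_action_set_inv:
  assumes P: "P \<in> LO G" and g: "g \<in> carrier G"
  shows "conj_action G g (set_inv P) = set_inv (conj_action G g P)"
  unfolding conj_action_eq[OF LO_D(1)[OF LO_set_inv[OF P]] g]
    set_inv_iff[OF LO_D(1)[OF LO_conj_action[OF P g]]]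
  unfolding set_inv_iff[OF LO_D(1)[OF P]] conj_action_eq[OF LO_D(1)[OF P] g]
  using g by (auto simp: conj_inv)

lemma set_inv_set_inv:
  assumes P: "P \<in> LO G"
  shows "set_inv (set_inv P) = P"
  unfolding set_inv_iff[OF LO_D(1)[OF LO_set_inv[OF P]]]
  unfolding set_inv_iff[OF LO_D(1)[OF P]]
  using LO_D(2)[OF P] by auto

lemma conj_action_inv:
  assumes P: "P \<in> LO G" and g: "g \<in> carrier G"
  shows "conj_action G (inv g) (conj_action G g P) = P"
proof -
  have cancel: "inv g \<otimes> (g \<otimes> h \<otimes> inv g) \<otimes> g = h" if "h \<in> carrier G" for h
    using that g by (simp add: m_assoc inv_cancel)
  show ?thesis
    unfolding conj_action_eq[OF LO_D(1)[OF LO_conj_action[OF P g]] inv_closed[OF g]]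
    unfolding conj_action_eq[OF LO_D(1)[OF P] g]
    using g LO_D(2)[OF P] by (auto simp: cancel)
qed

lemma E_lo_iff:
  assumes "P \<in> LO G"
  shows "E_lo G P Q \<longleftrightarrow> (\<exists>g\<in>carrier G. Q = conj_action G g P)"
  using assms LO_conj_action[OF assms] by (auto simp: E_lo_def orbit_def)

end

section \<open>The orderings given by points of the line\<close>

lemma nadic_of_int [simp]: "of_int m \<in> nadic n"
  unfolding nadic_def by (intro CollectI exI[of _ m] exI[of _ "0::nat"]) simp

lemma nadic_mult_int:
  assumes "x \<in> nadic n"
  shows "of_int c * x \<in> nadic n"
proof -
  obtain m i where "x = of_int m / of_nat n ^ i"
    using assms unfolding nadic_def by blast
  then have "of_int c * x = of_int (c * m) / of_nat n ^ i" by simp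
  then show ?thesis unfolding nadic_def by blast
qed

lemma nadic_add:
  assumes "n > 0" "x \<in> nadic n" "y \<in> nadic n"
  shows "x + y \<in> nadic n"
proof -
  obtain m i l j where xy: "x = of_int m / of_nat n ^ i" "y = of_int l / of_nat n ^ j"
    using assms unfolding nadic_def by blast
  have "x + y = of_int (m * int n ^ j + l * int n ^ i) / of_nat n ^ (i + j)"
    unfolding xy using assms(1) by (simp add: add_frac_eq power_add)
  then show ?thesis unfolding nadic_def by blast
qed

lemma nadic_dense:
  assumes "n \<ge> 2" "s < (t :: real)"
  shows "\<exists>y\<in>nadic n. s < y \<and> y < t"
proof -
  obtain i where i: "1 / (t - s) < real n ^ i"
    using real_arch_pow[of "real n" "1 / (t - s)"] assms(1) by auto
  have pos: "0 < real n ^ i" using assms(1) by simp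
  define m where "m = \<lfloor>real n ^ i * s\<rfloor> + 1"
  have "real n ^ i * s < of_int m" "of_int m \<le> real n ^ i * s + 1"
    unfolding m_def by linarith+
  moreover have "1 < real n ^ i * (t - s)"
    using i assms(2) by (simp add: pos_divide_less_eq)
  ultimately have "real n ^ i * s < of_int m" "of_int m < real n ^ i * t"
    by (simp_all add: right_diff_distrib)
  then have "s < of_int m / real n ^ i" "of_int m / real n ^ i < t"
    using pos by (simp_all add: pos_less_divide_eq pos_divide_less_eq mult.commute)
  then show ?thesis unfolding nadic_def by blast
qed

lemma countable_nadic: "countable (nadic n)"
proof -
  have "nadic n = (\<lambda>(m, i). of_int m / of_nat n ^ i) ` UNIV"
    unfolding nadic_def by auto
  then show ?thesis by simp
qed

context affine_coordinates
begin

lemma n_powi_pos [simp]: "0 < real n powi k"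
  using n_ge_2 by (intro zero_less_power_int) simp

lemma n_powi_add: "real n powi (k + l) = real n powi k * real n powi l"
  using n_ge_2 by (intro power_int_add) simp

lemma n_powi_gt_1:
  assumes "k > 0"
  shows "1 < real n powi k"
proof -
  have "1 < real n ^ nat k"
    using assms n_ge_2 by (intro one_less_power) auto
  then show ?thesis
    using assms by (simp add: power_int_def)
qed

definition act :: "'a \<Rightarrow> real \<Rightarrow> real" where
  "act g t = pt g + real n powi ht g * t"

lemma act_mult:
  "g \<in> carrier G \<Longrightarrow> h \<in> carrier G \<Longrightarrow> act (g \<otimes> h) t = act g (act h t)"
  by (simp add: act_def pt_mult ht_mult n_powi_add distrib_left)

lemma act_one [simp]: "act \<one> t = t"
  by (simp add: act_def)

lemma act_inv [simp]:
  "g \<in> carrier G \<Longrightarrow> act (inv g) (act g t) = t"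
  "g \<in> carrier G \<Longrightarrow> act g (act (inv g) t) = t"
  by (simp_all flip: act_mult)

lemma act_less_iff: "act g s < act g t \<longleftrightarrow> s < t"
  by (simp add: act_def)

lemma act_eq_iff: "act g s = act g t \<longleftrightarrow> s = t"
  using act_less_iff[of g s t] act_less_iff[of g t s] by (metis less_irrefl linorder_neqE)

lemma coords_eqI:
  "g \<in> carrier G \<Longrightarrow> h \<in> carrier G \<Longrightarrow> pt g = pt h \<Longrightarrow> ht g = ht h \<Longrightarrow> g = h"
  using coords_bij unfolding bij_betw_def inj_on_def by blast

lemma pt_nadic: "g \<in> carrier G \<Longrightarrow> pt g \<in> nadic n"
  using coords_bij unfolding bij_betw_def by auto

definition elt :: "real \<Rightarrow> int \<Rightarrow> 'a" where
  "elt x k = (THE g. g \<in> carrier G \<and> pt g = x \<and> ht g = k)"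

lemma elt:
  assumes "x \<in> nadic n"
  shows elt_carrier: "elt x k \<in> carrier G" and pt_elt: "pt (elt x k) = x" and ht_elt: "ht (elt x k) = k"
proof -
  have "(x, k) \<in> (\<lambda>g. (pt g, ht g)) ` carrier G"
    using coords_bij assms unfolding bij_betw_def by blast
  then obtain g where g: "g \<in> carrier G \<and> pt g = x \<and> ht g = k"
    by auto
  have "elt x k \<in> carrier G \<and> pt (elt x k) = x \<and> ht (elt x k) = k"
    unfolding elt_def using g
  proof (rule theI)
    fix h assume "h \<in> carrier G \<and> pt h = x \<and> ht h = k"
    then show "h = g" using g by (intro coords_eqI) simp_all
  qed
  then show "elt x k \<in> carrier G" "pt (elt x k) = x" "ht (elt x k) = k" by blast+
qed

lemma act_nadic:
  assumes "g \<in> carrier G" "y \<in> nadic n"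
  shows "act g y \<in> nadic n"
proof -
  have "act g y = pt (g \<otimes> elt y 0)"
    using assms by (simp add: act_def pt_mult elt)
  then show ?thesis using assms pt_nadic elt_carrier by simp
qed

lemma countable_carrier: "countable (carrier G)"
proof -
  have "countable (nadic n \<times> (UNIV :: int set))"
    by (intro countable_SIGMA countable_nadic countableI_type)
  then show ?thesis
    using coords_bij unfolding bij_betw_def
    by (intro countable_image_inj_on[of "\<lambda>g. (pt g, ht g)" "carrier G"]) simp_all
qed

text \<open>
The elements fixing \<open>t\<close> are determined by their height, so the sign of the height orders them.
\<close>

definition cone_at :: "real \<Rightarrow> 'a set" where
  "cone_at t = {g \<in> carrier G. t < act g t \<or> (act g t = t \<and> ht g > 0)}"

lemma act_fixed_parabolic:
  assumes "g \<in> carrier G" "act g t = t" "ht g = 0"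
  shows "g = \<one>"
  using assms by (intro coords_eqI) (simp_all add: act_def)

lemma cone_at_LO: "cone_at t \<in> LO G"
  unfolding LO_def mem_Collect_eq positive_cone_iff
proof (intro conjI ballI impI)
  show "cone_at t \<subseteq> carrier G" unfolding cone_at_def by blast
  show "\<one> \<notin> cone_at t" unfolding cone_at_def by simp
  fix g
  show "g \<otimes> h \<in> cone_at t" if gh_cone: "g \<in> cone_at t" "h \<in> cone_at t" for h
  proof -
    have gh: "g \<in> carrier G" "h \<in> carrier G" using gh_cone unfolding cone_at_def by blast+
    consider "t < act h t" | "act h t = t" "ht h > 0"
      using gh_cone(2) unfolding cone_at_def by auto
    then show ?thesis
    proof cases
      case 1
      then have "act g t < act g (act h t)" by (simp add: act_less_iff)
      moreover have "t \<le> act g t" using gh_cone(1) unfolding cone_at_def by auto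
      ultimately show ?thesis using gh unfolding cone_at_def by (simp add: act_mult)
    next
      case 2
      then show ?thesis using gh gh_cone(1) unfolding cone_at_def by (auto simp: act_mult ht_mult)
    qed
  qed
  assume g: "g \<in> carrier G" "g \<noteq> \<one>"
  then have "ht g \<noteq> 0 \<or> act g t \<noteq> t"
    using act_fixed_parabolic by blast
  moreover have "t < act (inv g) t \<longleftrightarrow> act g t < t" "act (inv g) t = t \<longleftrightarrow> act g t = t"
    using act_less_iff[of g t "act (inv g) t"] act_eq_iff[of g t "act (inv g) t"] g by auto
  ultimately show "inv g \<in> cone_at t \<longleftrightarrow> g \<notin> cone_at t"
    using g unfolding cone_at_def by (auto simp: ht_inv)
qed

lemma conj_cone_at:
  assumes g: "g \<in> carrier G"
  shows "conj_action G g (cone_at t) = cone_at (act g t)"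
proof -
  have sub: "cone_at t \<subseteq> carrier G" unfolding cone_at_def by blast
  have "t < act (inv g \<otimes> h \<otimes> g) t \<longleftrightarrow> act g t < act h (act g t)"
    "act (inv g \<otimes> h \<otimes> g) t = t \<longleftrightarrow> act h (act g t) = act g t"
    "ht (inv g \<otimes> h \<otimes> g) = ht h" if "h \<in> carrier G" for h
    using that g act_less_iff[of g t "act (inv g \<otimes> h \<otimes> g) t"]
      act_eq_iff[of g "act (inv g \<otimes> h \<otimes> g) t" t]
    by (auto simp: act_mult ht_mult ht_inv)
  then show ?thesis
    unfolding conj_action_eq[OF sub g] using g by (auto simp: cone_at_def)
qed

text \<open>
The map \<open>t \<mapsto> y + n (t - y)\<close>, which is the conjugate of \<open>b\<close> by the translation by \<open>y\<close>.
\<close>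

definition homothety :: "real \<Rightarrow> 'a" where
  "homothety y = elt (- (real n - 1) * y) 1"

lemma homothety:
  assumes "y \<in> nadic n"
  shows "homothety y \<in> carrier G" "ht (homothety y) = 1" "pt (homothety y) = - (real n - 1) * y"
    and "act (homothety y) t = y + real n * (t - y)"
proof -
  have "- (real n - 1) * y = of_int (1 - int n) * y" by simp
  then have *: "- (real n - 1) * y \<in> nadic n"
    using nadic_mult_int[OF assms, of "1 - int n"] by simp
  show "homothety y \<in> carrier G" "ht (homothety y) = 1" "pt (homothety y) = - (real n - 1) * y"
    unfolding homothety_def using elt[OF *] by simp_all
  then show "act (homothety y) t = y + real n * (t - y)"
    by (simp add: act_def algebra_simps)
qed

lemma homothety_cone_at:
  assumes "y \<in> nadic n"
  shows "homothety y \<in> cone_at t \<longleftrightarrow> y \<le> t"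
proof -
  have "y + real n * (t - y) = t + (real n - 1) * (t - y)"
    by (simp add: algebra_simps)
  moreover have "0 < real n - 1" using n_ge_2 by simp
  ultimately show ?thesis
    using homothety[OF assms] unfolding cone_at_def by (auto simp: zero_less_mult_iff)
qed

text \<open>
A homothety with centre strictly between two points distinguishes their cones.
\<close>

lemma cone_at_inject: "cone_at s = cone_at t \<longleftrightarrow> s = t"
proof
  have "\<not> s < t" if "cone_at s = cone_at t" for s t
  proof
    assume "s < t"
    then obtain y where "y \<in> nadic n" "s < y" "y < t"
      using nadic_dense n_ge_2 by blast
    then show False
      using homothety_cone_at[of y s] homothety_cone_at[of y t] that by simp
  qed
  then show "s = t" if "cone_at s = cone_at t"
    using that by (metis linorder_neqE)
qed simp

lemma E_lo_cone_at: "E_lo G (cone_at s) (cone_at t) \<longleftrightarrow> (\<exists>g\<in>carrier G. act g s = t)"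
  by (auto simp: E_lo_iff[OF cone_at_LO] conj_cone_at cone_at_inject)

end

section \<open>Classification of the orderings\<close>

context affine_coordinates
begin

lemma int_pow_fixed:
  assumes "g \<in> carrier G" "act g c = c"
  shows "act (g [^] (k::nat)) c = c"
  using assms by (induction k) (simp_all add: act_mult)

lemma ht_nat_pow: "g \<in> carrier G \<Longrightarrow> ht (g [^] (k::nat)) = int k * ht g"
  using ht_int_pow[of g "int k"] by (simp add: int_pow_int)

lemma pt_fixed: "act g c = c \<Longrightarrow> pt g = (1 - real n powi ht g) * c"
  by (simp add: act_def left_diff_distrib)

text \<open>
Used only for \<open>ht g > 0\<close>; the denominator vanishes for translations.
\<close>

definition fixed_point :: "'a \<Rightarrow> real" where
  "fixed_point g = pt g / (1 - real n powi ht g)"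

lemma act_fixed_point:
  assumes "ht g > 0"
  shows "act g c = c \<longleftrightarrow> c = fixed_point g"
proof -
  have "1 - real n powi ht g \<noteq> 0"
    using n_powi_gt_1[OF assms] by simp
  then have "c = fixed_point g \<longleftrightarrow> c * (1 - real n powi ht g) = pt g"
    by (simp add: fixed_point_def eq_divide_eq)
  moreover have "act g c - c = pt g - c * (1 - real n powi ht g)"
    by (simp add: act_def algebra_simps)
  ultimately show ?thesis
    by linarith
qed

text \<open>
For \<open>x = m/n\<^sup>i\<close>, the power with exponent \<open>n\<^sup>i\<close> of the translation by \<open>x\<close> is the \<open>m\<close>-th power of the
translation by \<open>1\<close>.
\<close>

lemma elt_pos_iff:
  assumes P: "P \<in> LO G" and x: "x \<in> nadic n" "x > 0"
  shows "elt x 0 \<in> P \<longleftrightarrow> elt 1 0 \<in> P"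
proof -
  obtain m i where mi: "x = of_int m / of_nat n ^ i"
    using x(1) unfolding nadic_def by blast
  have one: "1 \<in> nadic n" using nadic_of_int[of 1] by simp
  have "m > 0" using x(2) n_ge_2 unfolding mi by (simp add: zero_less_divide_iff)
  then obtain k where k: "m = int k" "k > 0"
    by (metis pos_int_cases)
  have pt: "pt (elt y 0 [^] (k::nat)) = real k * y" if "y \<in> nadic n" for y k
    using pt_int_pow[of "elt y 0" "int k"] elt[OF that] by (simp add: int_pow_int)
  have "elt x 0 [^] (n ^ i) = elt 1 0 [^] k"
    using pt[OF x(1), of "n ^ i"] pt[OF one, of k] elt[OF x(1), of 0] elt[OF one, of 0] n_ge_2
    by (intro coords_eqI) (simp_all add: ht_nat_pow mi k)
  then show ?thesis
    using LO_pow[OF P elt_carrier[OF x(1)], of "n ^ i" 0] LO_pow[OF P elt_carrier[OF one], of k 0]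
      k n_ge_2 by simp
qed

text \<open>
The supremum of the centres of the positive homotheties, written with the neutral value \<open>-\<infinity>\<close> at the other
points so that the index set does not depend on \<open>P\<close>.  The value is infinite if all or none of
the homotheties are positive.
\<close>

definition axis :: "'a set \<Rightarrow> ereal" where
  "axis P = (SUP y\<in>nadic n. if homothety y \<in> P then ereal y else -\<infinity>)"

text \<open>
The sign of the expanding elements that fix the axis; false if there are none.
\<close>

definition axis_positive :: "'a set \<Rightarrow> bool" where
  "axis_positive P \<longleftrightarrow> (\<exists>g\<in>P. ht g > 0 \<and> ereal (fixed_point g) = axis P)"

lemma nadic_between_ereal:
  assumes "s < (t :: ereal)"
  shows "\<exists>y\<in>nadic n. s < ereal y \<and> ereal y < t"
proof -
  obtain a where a: "s < ereal a" "ereal a < t"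
    using ereal_dense2[OF assms] by blast
  obtain b where b: "ereal a < ereal b" "ereal b < t"
    using ereal_dense2[OF a(2)] by blast
  obtain y where y: "y \<in> nadic n" "a < y" "y < b"
    using nadic_dense[OF n_ge_2, of a b] b(1) by auto
  have "s < ereal y"
    using a(1) y(2) by (metis less_ereal.simps(1) less_trans)
  moreover have "ereal y < t"
    using b(2) y(3) by (metis less_ereal.simps(1) less_trans)
  ultimately show ?thesis
    using y(1) by blast
qed

context
  fixes P assumes P: "P \<in> LO G" and upright: "elt 1 0 \<in> P"
begin

lemma translation_mult:
  assumes "g \<in> carrier G" "h \<in> P" "ht g = ht h" "pt h \<le> pt g"
  shows "g \<in> P"
proof (cases "pt h = pt g")
  case True
  then have "g = h"
    using assms LO_D(2)[OF P] by (intro coords_eqI) simp_all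
  then show ?thesis using assms(2) by simp
next
  case False
  have h: "h \<in> carrier G" using assms(2) LO_D(2)[OF P] by blast
  have diff: "pt g - pt h \<in> nadic n"
    using nadic_add[OF _ pt_nadic[OF assms(1)] nadic_mult_int[OF pt_nadic[OF h], of "- 1"]] n_ge_2
    by simp
  have eq: "elt (pt g - pt h) 0 \<otimes> h = g"
    using assms h elt[OF diff, of 0] by (intro coords_eqI) (simp_all add: pt_mult ht_mult)
  have "elt (pt g - pt h) 0 \<in> P"
    using elt_pos_iff[OF P diff] upright False assms(4) by simp
  from LO_D(3)[OF P this assms(2)] show ?thesis
    unfolding eq .
qed

lemma homothety_antimono:
  assumes "y \<in> nadic n" "z \<in> nadic n" "z \<le> y" "homothety y \<in> P"
  shows "homothety z \<in> P"
proof (rule translation_mult[OF _ assms(4)])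
  show "pt (homothety y) \<le> pt (homothety z)"
    using homothety(3)[OF assms(1)] homothety(3)[OF assms(2)] assms(3) n_ge_2
    by (simp add: mult_left_mono_neg)
qed (simp_all add: homothety assms)

lemma axis_cut:
  assumes "y \<in> nadic n"
  shows "ereal y < axis P \<Longrightarrow> homothety y \<in> P" and "axis P < ereal y \<Longrightarrow> homothety y \<notin> P"
proof -
  show "homothety y \<in> P" if "ereal y < axis P"
  proof -
    obtain z where z: "z \<in> nadic n" "ereal y < (if homothety z \<in> P then ereal z else -\<infinity>)"
      using \<open>ereal y < axis P\<close> unfolding axis_def less_SUP_iff by blast
    then show ?thesis
      using homothety_antimono[OF z(1) assms] by (auto split: if_splits)
  qed
  show "homothety y \<notin> P" if "axis P < ereal y"
  proof
    assume "homothety y \<in> P"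
    then have "ereal y \<le> axis P"
      unfolding axis_def by (intro SUP_upper2[OF assms]) simp
    then show False using \<open>axis P < ereal y\<close> by simp
  qed
qed

lemma axis_unique:
  assumes "\<And>y. y \<in> nadic n \<Longrightarrow> ereal y < t \<Longrightarrow> homothety y \<in> P"
    and "\<And>y. y \<in> nadic n \<Longrightarrow> t < ereal y \<Longrightarrow> homothety y \<notin> P"
  shows "axis P = t"
proof (rule ccontr)
  assume "axis P \<noteq> t"
  then consider "axis P < t" | "t < axis P" by (meson linorder_neqE)
  then show False
  proof cases
    case 1
    then show False using nadic_between_ereal[OF 1] assms(1) axis_cut(2) by blast
  next
    case 2
    then show False using nadic_between_ereal[OF 2] assms(2) axis_cut(1) by blast
  qed
qed

text \<open>
Compare \<open>g\<close>, of height \<open>k\<close>, with the \<open>k\<close>-th power of a homothety whose centre lies strictly between the fixed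
point of \<open>g\<close> and the axis.  They differ by a translation whose sign is known.
\<close>

lemma hyperbolic:
  assumes g: "g \<in> carrier G" "ht g > 0"
  shows "ereal (fixed_point g) < axis P \<Longrightarrow> g \<in> P" and "axis P < ereal (fixed_point g) \<Longrightarrow> g \<notin> P"
proof -
  let ?c = "fixed_point g"
  obtain k where k: "ht g = int k" "k > 0"
    using g(2) by (metis pos_int_cases)
  have ptg: "pt g = (1 - real n powi ht g) * ?c"
    using act_fixed_point[OF g(2)] by (intro pt_fixed) simp
  have gt: "1 < real n powi ht g" by (rule n_powi_gt_1[OF g(2)])
  have pow: "homothety y [^] k \<in> carrier G" "ht (homothety y [^] k) = ht g"
    "pt (homothety y [^] k) = (1 - real n powi ht g) * y"
    "homothety y [^] k \<in> P \<longleftrightarrow> homothety y \<in> P" if "y \<in> nadic n" for y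
  proof -
    have h: "homothety y \<in> carrier G" "act (homothety y) y = y" "ht (homothety y) = 1"
      using homothety[OF that] by simp_all
    then show "homothety y [^] k \<in> carrier G" "ht (homothety y [^] k) = ht g"
      using k by (simp_all add: ht_nat_pow)
    then show "pt (homothety y [^] k) = (1 - real n powi ht g) * y"
      using pt_fixed[OF int_pow_fixed[OF h(1,2), of k]] by simp
    show "homothety y [^] k \<in> P \<longleftrightarrow> homothety y \<in> P"
      using LO_pow[OF P h(1) k(2)] by simp
  qed
  show "g \<in> P" if less: "ereal ?c < axis P"
  proof -
    obtain y where y: "y \<in> nadic n" "?c < y" "ereal y < axis P"
      using nadic_between_ereal[OF less] by auto
    have "homothety y [^] k \<in> P" using pow(4)[OF y(1)] axis_cut(1)[OF y(1,3)] by blast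
    then show ?thesis
      using g gt y(2) pow[OF y(1)]
      by (intro translation_mult[of g "homothety y [^] k"]) (simp_all add: ptg mult_le_cancel_left)
  qed
  show "g \<notin> P" if less: "axis P < ereal ?c"
  proof
    assume "g \<in> P"
    obtain y where y: "y \<in> nadic n" "y < ?c" "axis P < ereal y"
      using nadic_between_ereal[OF less] by auto
    have "homothety y [^] k \<in> P"
      using \<open>g \<in> P\<close> gt y(2) pow[OF y(1)]
      by (intro translation_mult[of "homothety y [^] k" g]) (simp_all add: ptg mult_le_cancel_left)
    then show False using pow(4)[OF y(1)] axis_cut(2)[OF y(1,3)] by blast
  qed
qed

text \<open>
Two expanding elements with the same fixed point have a common power, so they have the same sign.
\<close>

lemma on_axis:
  assumes g: "g \<in> carrier G" "ht g > 0" "ereal (fixed_point g) = axis P"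
  shows "g \<in> P \<longleftrightarrow> axis_positive P"
proof
  assume "axis_positive P"
  then obtain h where h: "h \<in> P" "ht h > 0" "ereal (fixed_point h) = axis P"
    unfolding axis_positive_def by blast
  then have hG: "h \<in> carrier G" using LO_D(2)[OF P] by blast
  let ?c = "fixed_point g"
  have "ereal (fixed_point h) = ereal ?c" using g(3) h(3) by simp
  then have "fixed_point h = ?c" by simp
  then have fixed: "act g ?c = ?c" "act h ?c = ?c"
    using act_fixed_point[OF g(2), of ?c] act_fixed_point[OF h(2), of ?c] by simp_all
  obtain k l where kl: "ht g = int k" "k > 0" "ht h = int l" "l > 0"
    using g(2) h(2) by (metis pos_int_cases)
  have ht: "ht (g [^] l) = ht (h [^] k)"
    using g hG kl by (simp add: ht_nat_pow)
  have "g [^] l = h [^] k"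
    using pt_fixed[OF int_pow_fixed[OF g(1) fixed(1), of l]]
      pt_fixed[OF int_pow_fixed[OF hG fixed(2), of k]] g(1) hG ht
    by (intro coords_eqI) simp_all
  then show "g \<in> P"
    using LO_pow[OF P g(1) kl(4)] LO_pow[OF P hG kl(2)] h(1) by simp
next
  assume "g \<in> P"
  then show "axis_positive P"
    unfolding axis_positive_def using g(2,3) by blast
qed

end

definition extended_act :: "'a \<Rightarrow> ereal \<Rightarrow> ereal" where
  "extended_act g t = ereal (pt g) + ereal (real n powi ht g) * t"

lemma extended_act_simps:
  "extended_act g (ereal t) = ereal (act g t)"
  "extended_act g \<infinity> = \<infinity>" "extended_act g (- \<infinity>) = - \<infinity>"
  using n_ge_2 by (simp_all add: extended_act_def act_def)

lemma extended_act_less: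
  assumes "g \<in> carrier G"
  shows "ereal y < extended_act g t \<longleftrightarrow> ereal (act (inv g) y) < t"
    and "extended_act g t < ereal y \<longleftrightarrow> t < ereal (act (inv g) y)"
proof -
  have "y < act g r \<longleftrightarrow> act (inv g) y < r" "act g r < y \<longleftrightarrow> r < act (inv g) y" for r
    using act_less_iff[of g "act (inv g) y" r] act_less_iff[of g r "act (inv g) y"] assms
    by simp_all
  then show "ereal y < extended_act g t \<longleftrightarrow> ereal (act (inv g) y) < t"
    "extended_act g t < ereal y \<longleftrightarrow> t < ereal (act (inv g) y)"
    by (cases t; simp add: extended_act_simps)+
qed

text \<open>
The elements of positive height are decided by the axis, the translations by the sign of the translation by \<open>1\<close>, and the
elements of negative height by their inverses.
\<close>

lemma upright_determined:
  assumes P: "P \<in> LO G" "elt 1 0 \<in> P" and Q: "Q \<in> LO G" "elt 1 0 \<in> Q"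
    and axis: "axis P = axis Q" and pos: "axis_positive P = axis_positive Q"
  shows "P = Q"
proof -
  have up: "g \<in> P \<longleftrightarrow> g \<in> Q" if g: "g \<in> carrier G" "ht g > 0" for g
  proof -
    consider "ereal (fixed_point g) < axis P" | "axis P < ereal (fixed_point g)"
      | "ereal (fixed_point g) = axis P" by (meson linorder_neqE)
    then show ?thesis
    proof cases
      case 1
      then show ?thesis using hyperbolic(1)[OF P g] hyperbolic(1)[OF Q g] axis by simp
    next
      case 2
      then show ?thesis using hyperbolic(2)[OF P g] hyperbolic(2)[OF Q g] axis by simp
    next
      case 3
      then show ?thesis using on_axis[OF P g] on_axis[OF Q g] axis pos by simp
    qed
  qed
  have flat: "g \<in> P \<longleftrightarrow> g \<in> Q" if g: "g \<in> carrier G" "ht g = 0" for g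
  proof -
    have *: "elt (pt h) 0 = h" if "h \<in> carrier G" "ht h = 0" for h
      using that elt[OF pt_nadic[OF that(1)]] by (intro coords_eqI) simp_all
    have pos: "h \<in> P \<longleftrightarrow> h \<in> Q" if h: "h \<in> carrier G" "ht h = 0" "pt h > 0" for h
      using elt_pos_iff[OF P(1) pt_nadic[OF h(1)] h(3)] elt_pos_iff[OF Q(1) pt_nadic[OF h(1)] h(3)]
        P(2) Q(2) *[OF h(1,2)] by simp
    have "g = \<one>" if "pt g = 0"
      using g that by (intro coords_eqI) simp_all
    then consider "pt g > 0" | "pt g < 0" | "g = \<one>"
      by (meson linorder_neqE)
    then show ?thesis
    proof cases
      case 1
      then show ?thesis by (rule pos[OF g])
    next
      case 2
      have "pt (inv g) = - pt g"
        using pt_mult[of g "inv g"] g by simp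
      then have "inv g \<in> P \<longleftrightarrow> inv g \<in> Q"
        using g 2 by (intro pos) (simp_all add: ht_inv)
      moreover have "g \<noteq> \<one>" using 2 by auto
      ultimately show ?thesis
        using LO_D(5)[OF P(1) g(1)] LO_D(5)[OF Q(1) g(1)] by blast
    next
      case 3
      then show ?thesis using LO_D(4)[OF P(1)] LO_D(4)[OF Q(1)] by blast
    qed
  qed
  have "g \<in> P \<longleftrightarrow> g \<in> Q" if g: "g \<in> carrier G" for g
  proof -
    consider "ht g > 0" | "ht g = 0" | "ht g < 0" by linarith
    then show ?thesis
    proof cases
      case 1
      then show ?thesis by (rule up[OF g])
    next
      case 2
      then show ?thesis by (rule flat[OF g])
    next
      case 3
      then have "inv g \<in> P \<longleftrightarrow> inv g \<in> Q"
        using g by (intro up) (simp_all add: ht_inv)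
      moreover have "g \<noteq> \<one>" using 3 by auto
      ultimately show ?thesis
        using LO_D(5)[OF P(1) g] LO_D(5)[OF Q(1) g] by blast
    qed
  qed
  note same = this
  show ?thesis
  proof (rule Set.set_eqI)
    show "g \<in> P \<longleftrightarrow> g \<in> Q" for g
      using same[of g] LO_D(2)[OF P(1), of g] LO_D(2)[OF Q(1), of g] by blast
  qed
qed

text \<open>
A conjugate of the translation by \<open>1\<close> is again a translation to the right.
\<close>

lemma conj_elt_one:
  assumes P: "P \<in> LO G" and g: "g \<in> carrier G"
  shows "elt 1 0 \<in> conj_action G g P \<longleftrightarrow> elt 1 0 \<in> P"
proof -
  have one: "1 \<in> nadic n" using nadic_of_int[of 1] by simp
  let ?h = "inv g \<otimes> elt 1 0 \<otimes> g"
  have h: "?h \<in> carrier G" "ht ?h = 0"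
    using g elt[OF one, of 0] by (simp_all add: ht_mult ht_inv)
  have "pt ?h = act (inv g) (act (elt 1 0) (act g 0))"
    using g elt[OF one, of 0] h(2) act_def[of ?h 0] by (simp add: act_mult)
  also have "\<dots> > act (inv g) (act g 0)"
    using elt[OF one, of 0] by (simp add: act_less_iff act_def del: act_inv)
  finally have pos: "pt ?h > 0" using g by simp
  have "elt (pt ?h) 0 = ?h"
    using h elt[OF pt_nadic[OF h(1)]] by (intro coords_eqI) simp_all
  then show ?thesis
    using elt_pos_iff[OF P pt_nadic[OF h(1)] pos] elt_carrier[OF one, of 0]
    unfolding conj_action_eq[OF LO_D(1)[OF P] g] by simp
qed

lemma conj_homothety:
  assumes g: "g \<in> carrier G" and y: "y \<in> nadic n"
  shows "inv g \<otimes> homothety y \<otimes> g = homothety (act (inv g) y)"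
proof -
  have z: "act (inv g) y \<in> nadic n" using act_nadic[OF _ y] g by simp
  let ?h = "inv g \<otimes> homothety y \<otimes> g"
  have h: "?h \<in> carrier G" "ht ?h = 1"
    using g homothety[OF y] by (simp_all add: ht_mult ht_inv)
  have "act ?h (act (inv g) y) = act (inv g) y"
    using g homothety[OF y] by (simp add: act_mult)
  from pt_fixed[OF this] have "pt ?h = pt (homothety (act (inv g) y))"
    using h(2) homothety(3)[OF z] by (simp add: algebra_simps)
  then show ?thesis
    using h homothety[OF z] by (intro coords_eqI) simp_all
qed

lemma axis_conj:
  assumes P: "P \<in> LO G" "elt 1 0 \<in> P" and g: "g \<in> carrier G"
  shows "axis (conj_action G g P) = extended_act g (axis P)"
proof (rule axis_unique)
  show "conj_action G g P \<in> LO G" "elt 1 0 \<in> conj_action G g P"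
    using LO_conj_action[OF P(1) g] conj_elt_one[OF P(1) g] P(2) by simp_all
  fix y assume y: "y \<in> nadic n"
  have z: "act (inv g) y \<in> nadic n" using act_nadic[OF _ y] g by simp
  have "homothety y \<in> conj_action G g P \<longleftrightarrow> homothety (act (inv g) y) \<in> P"
    unfolding conj_action_eq[OF LO_D(1)[OF P(1)] g]
    using homothety(1)[OF y] conj_homothety[OF g y] by simp
  then show "ereal y < extended_act g (axis P) \<Longrightarrow> homothety y \<in> conj_action G g P"
    "extended_act g (axis P) < ereal y \<Longrightarrow> homothety y \<notin> conj_action G g P"
    using extended_act_less[OF g] axis_cut[OF P z] by simp_all
qed

lemma axis_positive_conj:
  assumes P: "P \<in> LO G" "elt 1 0 \<in> P" and g: "g \<in> carrier G"
  shows "axis_positive (conj_action G g P) \<longleftrightarrow> axis_positive P"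
proof -
  have imp: "axis_positive (conj_action G g P)"
    if P: "P \<in> LO G" "elt 1 0 \<in> P" and g: "g \<in> carrier G" and pos: "axis_positive P" for P g
  proof -
    obtain h where h: "h \<in> P" "ht h > 0" "ereal (fixed_point h) = axis P"
      using pos unfolding axis_positive_def by blast
    have hG: "h \<in> carrier G" using h(1) LO_D(2)[OF P(1)] by blast
    let ?k = "g \<otimes> h \<otimes> inv g"
    have k: "?k \<in> carrier G" "ht ?k > 0"
      using g hG h(2) by (simp_all add: ht_mult ht_inv)
    have "inv g \<otimes> ?k \<otimes> g = h"
      using g hG by (simp add: m_assoc inv_cancel)
    then have kP: "?k \<in> conj_action G g P"
      unfolding conj_action_eq[OF LO_D(1)[OF P(1)] g] using k(1) h(1) by simp
    have "act h (fixed_point h) = fixed_point h"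
      using act_fixed_point[OF h(2)] by simp
    then have "act ?k (act g (fixed_point h)) = act g (fixed_point h)"
      using g hG by (simp add: act_mult)
    then have "fixed_point ?k = act g (fixed_point h)"
      using act_fixed_point[OF k(2)] by simp
    then have "ereal (fixed_point ?k) = axis (conj_action G g P)"
      unfolding axis_conj[OF P g] using h(3)[symmetric] by (simp add: extended_act_simps)
    then show ?thesis
      unfolding axis_positive_def using kP k(2) by blast
  qed
  have "conj_action G g P \<in> LO G" "elt 1 0 \<in> conj_action G g P"
    using LO_conj_action[OF P(1) g] conj_elt_one[OF P(1) g] P(2) by simp_all
  from imp[OF this inv_closed[OF g]] show ?thesis
    using imp[OF P g] unfolding conj_action_inv[OF P(1) g] by blast
qed

text \<open>
One of \<open>P\<close> and its opposite makes translations to the right positive.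
\<close>

definition upright :: "'a set \<Rightarrow> 'a set" where
  "upright P = (if elt 1 0 \<in> P then P else set_inv P)"

lemma upright:
  assumes P: "P \<in> LO G"
  shows "upright P \<in> LO G" "elt 1 0 \<in> upright P"
proof -
  have one: "1 \<in> nadic n" using nadic_of_int[of 1] by simp
  have "elt 1 0 \<noteq> \<one>"
  proof
    assume "elt 1 0 = \<one>"
    then have "pt (elt 1 0) = 0" by simp
    then show False using pt_elt[OF one, of 0] by simp
  qed
  then have "inv (elt 1 0) \<in> P \<longleftrightarrow> elt 1 0 \<notin> P"
    by (rule LO_D(5)[OF P elt_carrier[OF one]])
  then show "elt 1 0 \<in> upright P"
    using elt_carrier[OF one, of 0]
    by (simp add: upright_def set_inv_iff[OF LO_D(1)[OF P]])
  show "upright P \<in> LO G"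
    using P LO_set_inv[OF P] by (simp add: upright_def)
qed

lemma upright_inject:
  assumes "P \<in> LO G" "Q \<in> LO G" "elt 1 0 \<in> P \<longleftrightarrow> elt 1 0 \<in> Q" "upright P = upright Q"
  shows "P = Q"
proof (cases "elt 1 0 \<in> P")
  case True
  then show ?thesis using assms(3,4) by (simp add: upright_def)
next
  case False
  then have "set_inv P = set_inv Q"
    using assms(3,4) by (simp add: upright_def)
  then have "set_inv (set_inv P) = set_inv (set_inv Q)"
    by (rule arg_cong)
  then show ?thesis
    unfolding set_inv_set_inv[OF assms(1)] set_inv_set_inv[OF assms(2)] .
qed

lemma upright_conj:
  assumes "P \<in> LO G" "g \<in> carrier G"
  shows "upright (conj_action G g P) = conj_action G g (upright P)"
  unfolding upright_def conj_elt_one[OF assms]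
  by (cases "elt 1 0 \<in> P") (simp_all add: conj_action_set_inv[OF assms])

text \<open>
Conjugation changes a cone only by moving its axis, so two cones with the same signs are conjugate
when their axes are in one orbit.
\<close>

theorem E_lo_classification:
  assumes P: "P \<in> LO G" and Q: "Q \<in> LO G"
  shows "E_lo G P Q \<longleftrightarrow> (elt 1 0 \<in> P \<longleftrightarrow> elt 1 0 \<in> Q) \<and>
    (axis_positive (upright P) \<longleftrightarrow> axis_positive (upright Q)) \<and>
    (\<exists>g\<in>carrier G. axis (upright Q) = extended_act g (axis (upright P)))" (is "_ \<longleftrightarrow> ?R")
proof
  assume "E_lo G P Q"
  then obtain g where g: "g \<in> carrier G" "Q = conj_action G g P"
    using E_lo_iff[OF P] by blast
  show ?R
    unfolding g(2) upright_conj[OF P g(1)] axis_conj[OF upright[OF P] g(1)]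
      axis_positive_conj[OF upright[OF P] g(1)] conj_elt_one[OF P g(1)]
    using g(1) by blast
next
  assume R: ?R
  then have sign: "elt 1 0 \<in> P \<longleftrightarrow> elt 1 0 \<in> Q"
    and pos: "axis_positive (upright P) \<longleftrightarrow> axis_positive (upright Q)" by blast+
  obtain g where g: "g \<in> carrier G" "axis (upright Q) = extended_act g (axis (upright P))"
    using R by blast
  let ?P = "conj_action G g P"
  have P': "?P \<in> LO G" by (rule LO_conj_action[OF P g(1)])
  have "upright ?P = upright Q"
    using upright[OF P'] upright[OF Q]
  proof (rule upright_determined)
    show "axis (upright ?P) = axis (upright Q)"
      unfolding upright_conj[OF P g(1)] axis_conj[OF upright[OF P] g(1)] g(2) ..
    show "axis_positive (upright ?P) = axis_positive (upright Q)"
      unfolding upright_conj[OF P g(1)] axis_positive_conj[OF upright[OF P] g(1)] by (rule pos)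
  qed
  moreover have "elt 1 0 \<in> ?P \<longleftrightarrow> elt 1 0 \<in> Q"
    unfolding conj_elt_one[OF P g(1)] by (rule sign)
  ultimately have "?P = Q"
    by (intro upright_inject[OF P' Q])
  then show "E_lo G P Q"
    unfolding E_lo_iff[OF P] using g(1) by (intro bexI[of _ g]) simp_all
qed

end

section \<open>Orbits of points and base-n digits\<close>

definition digit :: "nat \<Rightarrow> real \<Rightarrow> nat \<Rightarrow> nat" where
  "digit n t i = nat (\<lfloor>real n ^ Suc i * t\<rfloor> mod int n)"

lemma digit_less: "n > 0 \<Longrightarrow> digit n t i < n"
  by (simp add: digit_def nat_less_iff)

lemma digit_shift: "digit n t (i + l) = digit n (real n ^ i * t) l"
proof -
  have "real n ^ Suc (i + l) * t = real n ^ Suc l * (real n ^ i * t)"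
    by (simp add: power_add)
  then show ?thesis by (simp only: digit_def)
qed

lemma digit_add_int: "digit n (t + of_int m) i = digit n t i"
proof -
  have "real n ^ Suc i * (t + of_int m) = real n ^ Suc i * t + of_int (int n * (int n ^ i * m))"
    by (simp add: distrib_left)
  then have "\<lfloor>real n ^ Suc i * (t + of_int m)\<rfloor> = \<lfloor>real n ^ Suc i * t\<rfloor> + int n * (int n ^ i * m)"
    by (simp only: floor_add_int)
  then show ?thesis by (simp add: digit_def)
qed

lemma digit_frac: "digit n (frac t) i = digit n t i"
  using digit_add_int[of n "frac t" "\<lfloor>t\<rfloor>" i] by (simp add: frac_def)

lemma floor_digit:
  assumes "n > 0"
  shows "\<lfloor>real n ^ Suc i * t\<rfloor> = int n * \<lfloor>real n ^ i * t\<rfloor> + int (digit n t i)"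
proof -
  have "real n ^ i * t = (real n ^ Suc i * t) / of_int (int n)"
    using assms by simp
  then have "\<lfloor>real n ^ i * t\<rfloor> = \<lfloor>real n ^ Suc i * t\<rfloor> div int n"
    by (simp only: floor_divide_real_eq_div[of "int n"] of_nat_0_le_iff)
  moreover have "int (digit n t i) = \<lfloor>real n ^ Suc i * t\<rfloor> mod int n"
    using assms by (simp add: digit_def)
  ultimately show ?thesis
    using mult_div_mod_eq[of "int n" "\<lfloor>real n ^ Suc i * t\<rfloor>"] by simp
qed

text \<open>
Equal digits make the integer parts of \<open>n\<^sup>i u\<close> and \<open>n\<^sup>i v\<close> equal for all \<open>i\<close>, so \<open>|u - v| < n\<^sup>-\<^sup>i\<close>.
\<close>

lemma eq_if_digits_eq:
  assumes n: "n \<ge> 2" and u: "0 \<le> u" "u < 1" and v: "0 \<le> v" "v < 1"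
    and digits: "\<And>i. digit n u i = digit n v i"
  shows "u = v"
proof -
  have floors: "\<lfloor>real n ^ i * u\<rfloor> = \<lfloor>real n ^ i * v\<rfloor>" for i
  proof (induction i)
    case 0
    have "\<lfloor>u\<rfloor> = 0" "\<lfloor>v\<rfloor> = 0"
      using u v by (simp_all add: floor_eq_iff)
    then show ?case by simp
  next
    case (Suc i)
    then show ?case
      using floor_digit[of n i u] floor_digit[of n i v] digits[of i] n by simp
  qed
  have close: "real n ^ i * \<bar>u - v\<bar> < 1" for i
  proof -
    have "\<bar>real n ^ i * u - real n ^ i * v\<bar> < 1"
      using floors[of i] by linarith
    moreover have "real n ^ i * u - real n ^ i * v = real n ^ i * (u - v)"
      by (simp add: right_diff_distrib)
    ultimately show ?thesis
      by (simp add: abs_mult)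
  qed
  show ?thesis
  proof (rule ccontr)
    assume "u \<noteq> v"
    then have pos: "\<bar>u - v\<bar> > 0" by simp
    obtain i where "1 / \<bar>u - v\<bar> < real n ^ i"
      using real_arch_pow[of "real n" "1 / \<bar>u - v\<bar>"] n by auto
    then have "1 < real n ^ i * \<bar>u - v\<bar>"
      using pos by (simp add: pos_divide_less_eq)
    then show False using close[of i] by simp
  qed
qed

text \<open>
After multiplication by a large power of \<open>n\<close>, the translation part \<open>x\<close> becomes an integer, and the factor \<open>n\<^sup>k\<close> only shifts
the digits.  The relation between the shifts \<open>i\<close> and \<open>j\<close> gives back the height \<open>k\<close>.
\<close>

lemma digit_affine:
  assumes n: "n \<ge> 2" and x: "x \<in> nadic n" and s: "s = x + real n powi k * t"
  shows "\<exists>i j. int i - int j = k \<and> (\<forall>l. digit n t (i + l) = digit n s (j + l))"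
proof -
  obtain m j0 where m: "x = of_int m / of_nat n ^ j0"
    using x unfolding nadic_def by blast
  \<comment> \<open>The shift \<open>j\<close> is so large that \<open>n\<^sup>j x\<close> is an integer and \<open>k + j\<close> is not negative.\<close>
  define j where "j = j0 + nat (- k)"
  define i where "i = nat (k + int j)"
  have ij: "int i = k + int j" "j \<ge> j0"
    unfolding i_def j_def by simp_all
  have pos: "real n > 0" using n by simp
  have "real n ^ j = real n ^ (j - j0) * real n ^ j0"
    using ij(2) by (simp flip: power_add)
  then have x': "real n ^ j * x = of_int (m * int n ^ (j - j0))"
    using pos by (simp add: m)
  have "real n ^ j * real n powi k = real n powi (int j + k)"
    using pos by (subst power_int_add) simp_all
  also have "\<dots> = real n ^ i"
    using ij(1) by (simp add: add.commute flip: power_int_of_nat)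
  finally have "real n ^ j * s = real n ^ i * t + of_int (m * int n ^ (j - j0))"
    unfolding s distrib_left x' by (simp add: mult.assoc[symmetric])
  then have "digit n t (i + l) = digit n s (j + l)" for l
    by (simp only: digit_shift digit_add_int)
  then show ?thesis
    using ij(1) by (intro exI[of _ i] exI[of _ j]) simp
qed

text \<open>
For the converse of \<open>digit_affine\<close>, a common tail of digits means that \<open>n\<^sup>i t\<close> and \<open>n\<^sup>j s\<close> have the same fractional part.
\<close>

lemma tail_eq_digit_iff:
  assumes n: "n \<ge> 2"
  shows "tail_eq (digit n t) (digit n s) \<longleftrightarrow> (\<exists>k. \<exists>x\<in>nadic n. s = x + real n powi k * t)"
proof
  assume "\<exists>k. \<exists>x\<in>nadic n. s = x + real n powi k * t"
  then show "tail_eq (digit n t) (digit n s)"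
    unfolding tail_eq_def using digit_affine[OF n] by metis
next
  assume "tail_eq (digit n t) (digit n s)"
  then obtain i j where ij: "\<And>l. digit n t (i + l) = digit n s (j + l)"
    unfolding tail_eq_def by blast
  have "frac (real n ^ i * t) = frac (real n ^ j * s)"
  proof (rule eq_if_digits_eq[OF n])
    show "digit n (frac (real n ^ i * t)) l = digit n (frac (real n ^ j * s)) l" for l
      unfolding digit_frac digit_shift[symmetric] by (rule ij)
  qed (simp_all add: frac_lt_1)
  then have "real n ^ j * s = real n ^ i * t + of_int (\<lfloor>real n ^ j * s\<rfloor> - \<lfloor>real n ^ i * t\<rfloor>)"
    by (simp add: frac_def)
  then obtain m where m: "real n ^ j * s = real n ^ i * t + of_int m"
    by blast
  have pos: "real n ^ j > 0" using n by simp
  have "s = (real n ^ i * t + of_int m) / real n ^ j"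
    using m pos by (simp add: eq_divide_eq mult.commute)
  also have "\<dots> = of_int m / of_nat n ^ j + (real n ^ i / real n ^ j) * t"
    by (simp add: add_divide_distrib)
  also have "real n ^ i / real n ^ j = real n powi (int i - int j)"
    using n by (simp add: power_int_diff)
  finally show "\<exists>k. \<exists>x\<in>nadic n. s = x + real n powi k * t"
    unfolding nadic_def by blast
qed

section \<open>Points with prescribed digits\<close>

definition expansion :: "nat \<Rightarrow> (nat \<Rightarrow> nat) \<Rightarrow> real" where
  "expansion n d = (\<Sum>i. real (d i) / real n ^ Suc i)"

lemma geometric_expansion:
  assumes "n \<ge> 2"
  shows "(\<lambda>i. real (n - 1) / real n ^ Suc i) sums 1"
proof -
  have "(\<lambda>i. (1 / real n) ^ i) sums (1 / (1 - 1 / real n))"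
    using assms by (intro geometric_sums) simp
  from sums_mult[OF this, of "real (n - 1) / real n"]
  have "(\<lambda>i. (real (n - 1) / real n) * (1 / real n) ^ i) sums
      ((real (n - 1) / real n) * (1 / (1 - 1 / real n)))" .
  moreover have "(real (n - 1) / real n) * (1 / (1 - 1 / real n)) = 1"
    using assms by (simp add: of_nat_diff field_simps)
  moreover have "(real (n - 1) / real n) * (1 / real n) ^ i = real (n - 1) / real n ^ Suc i" for i
    by (simp add: power_one_over)
  ultimately show ?thesis by (simp only: HOL.simp_thms)
qed

context
  fixes n :: nat and d :: "nat \<Rightarrow> nat"
  assumes n: "n \<ge> 2" and d: "\<And>i. d i < n"
begin

lemma summable_expansion: "summable (\<lambda>i. real (d (k + i)) / real n ^ Suc i)"
proof (rule summable_comparison_test')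
  show "summable (\<lambda>i. real (n - 1) / real n ^ Suc i)"
    using geometric_expansion[OF n] by (rule sums_summable)
  show "norm (real (d (k + i)) / real n ^ Suc i) \<le> real (n - 1) / real n ^ Suc i" for i
  proof -
    have "d (k + i) \<le> n - 1" using d[of "k + i"] by simp
    then show ?thesis by (simp add: divide_right_mono)
  qed
qed

lemma expansion_bounds: "0 \<le> expansion n (\<lambda>i. d (k + i))" "expansion n (\<lambda>i. d (k + i)) \<le> 1"
proof -
  show "0 \<le> expansion n (\<lambda>i. d (k + i))"
    unfolding expansion_def by (rule suminf_nonneg[OF summable_expansion]) simp
  have "d (k + i) \<le> n - 1" for i using d[of "k + i"] by simp
  then have "expansion n (\<lambda>i. d (k + i)) \<le> (\<Sum>i. real (n - 1) / real n ^ Suc i)"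
    unfolding expansion_def using geometric_expansion[OF n]
    by (intro suminf_le summable_expansion sums_summable divide_right_mono) simp_all
  then show "expansion n (\<lambda>i. d (k + i)) \<le> 1"
    using sums_unique[OF geometric_expansion[OF n]] by simp
qed

lemma expansion_step: "real n * expansion n (\<lambda>i. d (k + i)) = real (d k) + expansion n (\<lambda>i. d (Suc k + i))"
proof -
  have "expansion n (\<lambda>i. d (k + i)) =
      (\<Sum>i. real (d (k + Suc i)) / real n ^ Suc (Suc i)) + real (d k) / real n"
    unfolding expansion_def using suminf_split_head[OF summable_expansion[of k]] by simp
  also have "(\<Sum>i. real (d (k + Suc i)) / real n ^ Suc (Suc i)) = expansion n (\<lambda>i. d (Suc k + i)) / real n"
    unfolding expansion_def
    using suminf_divide[OF summable_expansion[of "Suc k"], of "real n"] by (simp add: mult.commute)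
  finally show ?thesis
    using n by (simp add: distrib_left)
qed

text \<open>
Multiplication by \<open>n\<^sup>k\<close> moves the first \<open>k\<close> digits into the integer part.
\<close>

lemma expansion_power:
  "\<exists>m :: int. real n ^ k * expansion n d = of_int m + expansion n (\<lambda>i. d (k + i))"
proof (induction k)
  case 0
  show ?case by (intro exI[of _ 0]) simp
next
  case (Suc k)
  then obtain m :: int where m: "real n ^ k * expansion n d = of_int m + expansion n (\<lambda>i. d (k + i))"
    by blast
  have "real n ^ Suc k * expansion n d = real n * of_int m + real n * expansion n (\<lambda>i. d (k + i))"
    using m by (simp add: mult.assoc distrib_left)
  also have "\<dots> = of_int (int n * m + int (d k)) + expansion n (\<lambda>i. d (Suc k + i))"
    unfolding expansion_step by simp
  finally show ?case by blast
qed

text \<open>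
Only the sequence with all digits equal to \<open>n - 1\<close> represents \<open>1\<close>.
\<close>

lemma expansion_less_1:
  assumes "j \<ge> k" "d j < n - 1"
  shows "expansion n (\<lambda>i. d (k + i)) < 1"
  using assms(1)
proof (induction k rule: inc_induct)
  case base
  have "real n * expansion n (\<lambda>i. d (j + i)) \<le> real (d j) + 1"
    unfolding expansion_step using expansion_bounds(2)[of "Suc j"] by simp
  also have "\<dots> < real n * 1" using assms(2) by linarith
  finally show ?case using n by (simp only: mult_less_cancel_left_pos)
next
  case (step k)
  have "real n * expansion n (\<lambda>i. d (k + i)) < real (d k) + 1"
    unfolding expansion_step using step.IH by simp
  also have "\<dots> \<le> real n * 1" using d[of k] by linarith
  finally show ?case using n by simp
qed

text \<open>
The assumption excludes the expansions that end in digits \<open>n - 1\<close>, since taking integer parts never produces them.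
\<close>

lemma digit_expansion:
  assumes "\<And>k. \<exists>j\<ge>k. d j < n - 1"
  shows "digit n (expansion n d) k = d k"
proof -
  obtain m :: int where "real n ^ k * expansion n d = of_int m + expansion n (\<lambda>i. d (k + i))"
    using expansion_power by blast
  then have "real n ^ Suc k * expansion n d = real n * of_int m + real n * expansion n (\<lambda>i. d (k + i))"
    by (simp add: mult.assoc distrib_left)
  also have "\<dots> = expansion n (\<lambda>i. d (Suc k + i)) + of_int (int n * m + int (d k))"
    unfolding expansion_step by simp
  finally have "\<lfloor>real n ^ Suc k * expansion n d\<rfloor> = \<lfloor>expansion n (\<lambda>i. d (Suc k + i))\<rfloor> + (int n * m + int (d k))"
    by (simp only: floor_add_int)
  moreover have "\<lfloor>expansion n (\<lambda>i. d (Suc k + i))\<rfloor> = 0"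
    using expansion_bounds(1)[of "Suc k"] expansion_less_1[of "Suc k"] assms[of "Suc k"]
    by (auto simp: floor_eq_iff)
  ultimately show ?thesis
    using d[of k] by (simp add: digit_def)
qed

end

lemma expansion_close:
  assumes n: "n \<ge> 2" and d: "\<And>i. d i < n" and e: "\<And>i. e i < n"
    and agree: "\<And>i. i < k \<Longrightarrow> d i = e i"
  shows "\<bar>expansion n d - expansion n e\<bar> \<le> 1 / real n ^ k"
proof -
  have split: "expansion n f = (\<Sum>i<k. real (f i) / real n ^ Suc i) + expansion n (\<lambda>i. f (k + i)) / real n ^ k"
    if f: "\<And>i. f i < n" for f
  proof -
    have summable: "summable (\<lambda>i. real (f i) / real n ^ Suc i)"
      using summable_expansion[of n f 0, OF n f] by simp
    have "expansion n f = (\<Sum>i. real (f (i + k)) / real n ^ Suc (i + k)) + (\<Sum>i<k. real (f i) / real n ^ Suc i)"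
      unfolding expansion_def by (rule suminf_split_initial_segment[OF summable])
    also have "(\<Sum>i. real (f (i + k)) / real n ^ Suc (i + k)) = (\<Sum>i. real (f (k + i)) / real n ^ Suc i / real n ^ k)"
      by (simp add: power_add add.commute mult.commute mult.left_commute)
    also have "\<dots> = expansion n (\<lambda>i. f (k + i)) / real n ^ k"
      unfolding expansion_def by (rule suminf_divide[OF summable_expansion[of n f, OF n f]])
    finally show ?thesis by simp
  qed
  have "(\<Sum>i<k. real (d i) / real n ^ Suc i) = (\<Sum>i<k. real (e i) / real n ^ Suc i)"
    using agree by simp
  then have "expansion n d - expansion n e =
      (expansion n (\<lambda>i. d (k + i)) - expansion n (\<lambda>i. e (k + i))) / real n ^ k"
    using split[of d, OF d] split[of e, OF e] unfolding diff_divide_distrib by linarith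
  moreover have "\<bar>expansion n (\<lambda>i. d (k + i)) - expansion n (\<lambda>i. e (k + i))\<bar> \<le> 1"
    using expansion_bounds[of n d, OF n d, of k] expansion_bounds[of n e, OF n e, of k] by linarith
  ultimately show ?thesis
    by (simp add: abs_divide divide_right_mono)
qed

section \<open>Digit sequences that code eventual equality\<close>

text \<open>
The powers of two with even exponent are always marked and make shifts visible; the one with exponent
\<open>2m + 1\<close> carries \<open>x m\<close>.
\<close>

definition marker :: "(nat \<Rightarrow> bool) \<Rightarrow> nat \<Rightarrow> nat" where
  "marker x p = of_bool (\<exists>j. p = 2 ^ j \<and> (even j \<or> x (j div 2)))"

lemma marker_le_1: "marker x p \<le> 1"
  by (simp add: marker_def)

lemma marker_even: "marker x (2 ^ (2 * m)) = 1"
  by (auto simp: marker_def)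

lemma marker_odd: "marker x (2 ^ Suc (2 * m)) = of_bool (x m)"
proof -
  have "(2::nat) ^ Suc (2 * m) = 2 ^ j \<longleftrightarrow> j = Suc (2 * m)" for j
    by (metis one_less_numeral_iff power_inject_exp semiring_norm(76))
  then show ?thesis
    by (simp only: marker_def) simp
qed

lemma marker_not_power: "(\<And>j. p \<noteq> 2 ^ j) \<Longrightarrow> marker x p = 0"
  by (simp add: marker_def)

lemma marker_sparse: "\<exists>j\<ge>k. marker x j = 0"
\<comment> \<open>The witness is an odd number greater than \<open>1\<close>.\<close>
proof (intro exI conjI marker_not_power)
  show "k \<le> 2 ^ Suc k + 1"
    using less_exp[of "Suc k"] by linarith
  fix j
  show "(2::nat) ^ Suc k + 1 \<noteq> 2 ^ j"
  proof
    assume eq: "(2::nat) ^ Suc k + 1 = 2 ^ j"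
    have "odd ((2::nat) ^ Suc k + 1)" by simp
    then have "j = 0" unfolding eq by simp
    then show False using eq by simp
  qed
qed

text \<open>
A marked power \<open>p = 2\<^sup>2\<^sup>j\<close> in the common tail would be moved by \<open>k < p\<close> to a marked place, but there is no power of two strictly
between \<open>p\<close> and \<open>2p\<close>.
\<close>

lemma marker_shift_le:
  assumes "\<And>l. marker x (i + l) = marker y (j + l)"
  shows "j \<le> i"
proof (rule ccontr)
  assume "\<not> j \<le> i"
  define k where "k = j - i"
  have k: "0 < k" "j = i + k" using \<open>\<not> j \<le> i\<close> by (auto simp: k_def)
  define p :: nat where "p = 2 ^ (2 * j)"
  have p: "j < p"
    unfolding p_def using less_exp[of "2 * j"] by linarith
  then have "marker x p = marker y (p + k)"
    using assms[of "p - i"] k by (simp add: ac_simps)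
  then have "marker y (p + k) = 1"
    unfolding p_def marker_even by simp
  then obtain q where q: "p + k = 2 ^ q"
    using marker_not_power[of "p + k" y] by fastforce
  have "(2::nat) ^ (2 * j) < 2 ^ q" "(2::nat) ^ q < 2 ^ Suc (2 * j)"
    unfolding q[symmetric] power_Suc p_def[symmetric] using k p by simp_all
  then have "2 * j < q" "q < Suc (2 * j)"
    by (simp_all only: power_strict_increasing_iff one_less_numeral_iff semiring_norm)
  then show False by simp
qed

lemma marker_shift:
  assumes "\<And>l. marker x (i + l) = marker y (j + l)"
  shows "i = j"
proof (rule antisym)
  show "j \<le> i" by (rule marker_shift_le[OF assms])
  show "i \<le> j" by (rule marker_shift_le[OF assms[symmetric]])
qed

lemma marker_agree:
  assumes "\<And>m. m < k \<Longrightarrow> x m = y m" "p < k"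
  shows "marker x p = marker y p"
proof -
  have "x (j div 2) = y (j div 2)" if "p = 2 ^ j" for j
  proof (rule assms(1))
    have "j div 2 \<le> j" by simp
    also have "j < 2 ^ j" by (rule less_exp)
    finally show "j div 2 < k" using that assms(2) by simp
  qed
  then show ?thesis
    unfolding marker_def by (intro arg_cong[of _ _ of_bool]) blast
qed

text \<open>
A common tail must be unshifted by \<open>marker_shift\<close>, and then it shows all but finitely many values \<open>x m\<close>.
\<close>

lemma tail_eq_marker_iff: "tail_eq (marker x) (marker y) \<longleftrightarrow> E0 x y"
proof
  assume "tail_eq (marker x) (marker y)"
  then obtain i j where ij: "\<And>l. marker x (i + l) = marker y (j + l)"
    unfolding tail_eq_def by blast
  have "i = j" by (rule marker_shift[OF ij])
  have "m < i" if "x m \<noteq> y m" for m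
  proof (rule ccontr)
    assume "\<not> m < i"
    moreover have "m < 2 ^ Suc (2 * m)"
      using less_exp[of "Suc (2 * m)"] by linarith
    ultimately have "marker x (2 ^ Suc (2 * m)) = marker y (2 ^ Suc (2 * m))"
      using ij[of "2 ^ Suc (2 * m) - i"] \<open>i = j\<close> by simp
    then show False using that unfolding marker_odd by (cases "x m"; cases "y m") simp_all
  qed
  then have "{m. x m \<noteq> y m} \<subseteq> {..<i}"
    by blast
  then show "E0 x y"
    unfolding E0_def by (rule finite_subset) simp
next
  assume "E0 x y"
  then obtain N where "\<forall>m\<in>{m. x m \<noteq> y m}. m < N"
    unfolding E0_def finite_nat_set_iff_bounded ..
  then have N: "m < N" if "x m \<noteq> y m" for m
    using that by blast
  have "marker x (2 ^ (2 * N) + l) = marker y (2 ^ (2 * N) + l)" for l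
  proof -
    have "x (j div 2) = y (j div 2)" if j: "2 ^ (2 * N) + l = 2 ^ j" for j
    proof -
      have "(2::nat) ^ (2 * N) \<le> 2 ^ j" unfolding j[symmetric] by (rule le_add1)
      then have "2 * N \<le> j" by (rule power_le_imp_le_exp[rotated]) simp
      then have "\<not> j div 2 < N" by simp
      then show ?thesis using N[of "j div 2"] by blast
    qed
    then show ?thesis
      unfolding marker_def by (intro arg_cong[of _ _ of_bool]) blast
  qed
  then show "tail_eq (marker x) (marker y)"
    unfolding tail_eq_def by blast
qed

definition marked_point :: "nat \<Rightarrow> (nat \<Rightarrow> bool) \<Rightarrow> real" where
  "marked_point n x = expansion n (marker x)"

lemma digit_marked_point:
  assumes "n \<ge> 2"
  shows "digit n (marked_point n x) = marker x"
proof
  fix k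
  have "\<exists>j\<ge>k. marker x j < n - 1" for k
    using marker_sparse[of k x] assms by fastforce
  moreover have "marker x i < n" for i
    using marker_le_1[of x i] assms by linarith
  ultimately show "digit n (marked_point n x) k = marker x k"
    unfolding marked_point_def by (intro digit_expansion[OF assms])
qed

lemma openin_cantorI:
  assumes "\<And>x. x \<in> U \<Longrightarrow> \<exists>k. \<forall>y. (\<forall>i<k. y i = x i) \<longrightarrow> y \<in> U"
  shows "openin cantor_space U"
  unfolding cantor_space_def openin_product_topology_alt
proof
  fix x assume "x \<in> U"
  from assms[OF this] obtain k where k: "\<forall>y. (\<forall>i<k. y i = x i) \<longrightarrow> y \<in> U"
    by blast
  let ?V = "\<lambda>i. if i < k then {x i} else UNIV"
  show "\<exists>V. finite {i \<in> UNIV. V i \<noteq> topspace (discrete_topology UNIV)} \<and>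
      (\<forall>i\<in>UNIV. openin (discrete_topology UNIV) (V i)) \<and> x \<in> Pi\<^sub>E UNIV V \<and> Pi\<^sub>E UNIV V \<subseteq> U"
  proof (intro exI[of _ ?V] conjI subsetI)
    show "finite {i \<in> UNIV. ?V i \<noteq> topspace (discrete_topology UNIV)}"
      by (rule finite_subset[of _ "{..<k}"]) auto
    show "\<forall>i\<in>UNIV. openin (discrete_topology UNIV) (?V i)"
      by simp
    show "x \<in> Pi\<^sub>E UNIV ?V"
      by (simp add: PiE_iff)
    fix y assume y: "y \<in> Pi\<^sub>E UNIV ?V"
    have "y i = x i" if "i < k" for i
      using PiE_mem[OF y UNIV_I, of i] that by simp
    then show "y \<in> U" using k by blast
  qed
qed

text \<open>
The point depends continuously on the sequence, because long common prefixes give long common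
strings of digits.
\<close>

lemma openin_marked_point:
  assumes n: "n \<ge> 2" and S: "open S"
  shows "openin cantor_space {x. marked_point n x \<in> S}"
proof (rule openin_cantorI)
  fix x assume "x \<in> {x. marked_point n x \<in> S}"
  then obtain e where e: "e > 0" "\<And>t. dist t (marked_point n x) < e \<Longrightarrow> t \<in> S"
    using S unfolding open_dist by blast
  obtain k where k: "(1 / real n) ^ k < e"
    using real_arch_pow_inv[OF e(1), of "1 / real n"] n by auto
  have bound: "marker z i < n" for z i
    using marker_le_1[of z i] n by linarith
  have "marked_point n y \<in> S" if "\<forall>i<k. y i = x i" for y
  proof (rule e(2))
    have "\<bar>marked_point n y - marked_point n x\<bar> \<le> 1 / real n ^ k"
      unfolding marked_point_def
      using that by (intro expansion_close[OF n] bound) (rule marker_agree, auto)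
    also have "\<dots> < e" using k by (simp add: power_one_over)
    finally show "dist (marked_point n y) (marked_point n x) < e"
      by (simp add: dist_real_def)
  qed
  then show "\<exists>k. \<forall>y. (\<forall>i<k. y i = x i) \<longrightarrow> y \<in> {x. marked_point n x \<in> S}"
    by blast
qed

section \<open>The two reductions\<close>

lemma space_borel_of: "space (borel_of X) = topspace X"
  by (simp add: borel_of_def space_measure_of_conv)

lemma sets_borel_of: "sets (borel_of X) = sigma_sets (topspace X) {U. openin X U}"
  unfolding borel_of_def by (rule sets_measure_of) (auto dest: openin_subset)

lemma measurable_borel_of_if_continuous_map:
  assumes "continuous_map X Y f"
  shows "f \<in> measurable (borel_of X) (borel_of Y)"
  unfolding borel_of_def[of Y]
proof (rule measurable_measure_of)
  show "{U. openin Y U} \<subseteq> Pow (topspace Y)"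
    by (auto dest: openin_subset)
  show "f \<in> space (borel_of X) \<rightarrow> topspace Y"
    using assms by (auto simp: space_borel_of continuous_map_def)
  fix U assume "U \<in> {U. openin Y U}"
  then have "openin X {x \<in> topspace X. f x \<in> U}"
    using assms by (simp add: continuous_map_def)
  moreover have "f -` U \<inter> space (borel_of X) = {x \<in> topspace X. f x \<in> U}"
    by (auto simp: space_borel_of)
  ultimately show "f -` U \<inter> space (borel_of X) \<in> sets (borel_of X)"
    by (simp add: sets_borel_of sigma_sets.Basic)
qed

lemma continuous_map_LO_topology:
  assumes LO: "\<And>x. x \<in> topspace X \<Longrightarrow> f x \<in> LO G"
    and "\<And>g. g \<in> carrier G \<Longrightarrow> openin X {x \<in> topspace X. g \<in> f x}"
    and "\<And>g. g \<in> carrier G \<Longrightarrow> openin X {x \<in> topspace X. g \<notin> f x}"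
  shows "continuous_map X (LO_topology G) f"
proof -
  let ?\<iota> = "\<lambda>P. restrict (\<lambda>g. g \<in> P) (carrier G)"
  have "continuous_map X (discrete_topology UNIV) (\<lambda>x. g \<in> f x)" if g: "g \<in> carrier G" for g
    unfolding continuous_map_def
  proof (intro conjI allI impI)
    fix B :: "bool set"
    have "{x \<in> topspace X. (g \<in> f x) \<in> B} =
        (if True \<in> B then {x \<in> topspace X. g \<in> f x} else {}) \<union>
        (if False \<in> B then {x \<in> topspace X. g \<notin> f x} else {})"
      by (auto split: if_splits) (metis (full_types))+
    also have "openin X \<dots>"
      using assms(2,3)[OF g] by (intro openin_Un) simp_all
    finally show "openin X {x \<in> topspace X. (g \<in> f x) \<in> B}" .
  qed simp
  then have "continuous_map X (product_topology (\<lambda>_. discrete_topology UNIV) (carrier G)) (\<lambda>x. ?\<iota> (f x))"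
    by (simp add: continuous_map_componentwise restrict_def image_subset_iff extensional_def)
  then have "continuous_map X (product_topology (\<lambda>_. discrete_topology UNIV) (carrier G)) (?\<iota> \<circ> f)"
    by (simp add: comp_def)
  moreover have "topspace X \<subseteq> f -` LO G"
    using LO by auto
  ultimately show ?thesis
    unfolding LO_topology_def by (rule continuous_map_pullback')
qed

lemma measurable_LO_mem:
  assumes "g \<in> carrier G"
  shows "Measurable.pred (borel_of (LO_topology G)) (\<lambda>P. g \<in> P)"
proof -
  let ?\<iota> = "\<lambda>P. restrict (\<lambda>g. g \<in> P) (carrier G)"
  let ?T = "product_topology (\<lambda>_. discrete_topology (UNIV :: bool set)) (carrier G)"
  have "openin ?T {h \<in> topspace ?T. h g \<in> {True}}"
    using continuous_map_product_projection[OF assms, of "\<lambda>_. discrete_topology (UNIV :: bool set)"]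
    by (rule openin_continuous_map_preimage) simp
  then have "openin (LO_topology G) (?\<iota> -` {h \<in> topspace ?T. h g \<in> {True}} \<inter> LO G)"
    unfolding LO_topology_def openin_pullback_topology by blast
  also have "?\<iota> -` {h \<in> topspace ?T. h g \<in> {True}} \<inter> LO G = {P \<in> LO G. g \<in> P}"
    using assms by auto
  finally have "{P \<in> LO G. g \<in> P} \<in> sets (borel_of (LO_topology G))"
    by (simp add: sets_borel_of sigma_sets.Basic)
  then show ?thesis
    by (simp add: pred_def space_borel_of topspace_LO_topology)
qed

context affine_coordinates
begin

definition marked_cone :: "(nat \<Rightarrow> bool) \<Rightarrow> 'a set" where
  "marked_cone x = cone_at (marked_point n x)"

text \<open>
An element fixing the point makes its digit sequence overlap with a shift of itself, and
\<open>marker_shift\<close> forces the shift to be zero.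
\<close>

lemma marked_point_no_fixed:
  assumes "g \<in> carrier G" "act g (marked_point n x) = marked_point n x"
  shows "g = \<one>"
proof -
  have "marked_point n x = pt g + real n powi ht g * marked_point n x"
    using assms(2) by (simp add: act_def)
  from digit_affine[OF n_ge_2 pt_nadic[OF assms(1)] this]
  obtain i j where ij: "int i - int j = ht g" "\<And>l. marker x (i + l) = marker x (j + l)"
    unfolding digit_marked_point[OF n_ge_2] by blast
  have "i = j" by (rule marker_shift[OF ij(2)])
  then have "ht g = 0" using ij(1) by simp
  then show ?thesis
    using act_fixed_parabolic assms by blast
qed

lemma continuous_act: "continuous_on UNIV (act g)"
  unfolding act_def by (intro continuous_intros)

text \<open>
No nontrivial element fixes a marked point, so being positive and being negative are both
given by strict inequalities, which are open conditions.
\<close>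

lemma continuous_marked_cone: "continuous_map cantor_space (LO_topology G) marked_cone"
proof (rule continuous_map_LO_topology)
  have top: "topspace cantor_space = UNIV"
    by (simp add: cantor_space_def)
  show "marked_cone x \<in> LO G" for x
    unfolding marked_cone_def by (rule cone_at_LO)
  fix g assume g: "g \<in> carrier G"
  have open1: "open {t. t < act g t}" and open2: "open {t. act g t < t}"
    using continuous_act[of g] by (intro open_Collect_less continuous_intros; simp)+
  have *: "g \<in> marked_cone x \<longleftrightarrow> marked_point n x < act g (marked_point n x)"
    "g \<notin> marked_cone x \<longleftrightarrow> act g (marked_point n x) < marked_point n x" if "g \<noteq> \<one>" for x
  proof -
    have "act g (marked_point n x) \<noteq> marked_point n x"
      using marked_point_no_fixed[OF g, of x] that by blast
    then show "g \<in> marked_cone x \<longleftrightarrow> marked_point n x < act g (marked_point n x)"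
      "g \<notin> marked_cone x \<longleftrightarrow> act g (marked_point n x) < marked_point n x"
      using g unfolding marked_cone_def cone_at_def by auto
  qed
  have one: "\<one> \<notin> marked_cone x" for x
    unfolding marked_cone_def by (rule LO_D(4)[OF cone_at_LO])
  show "openin cantor_space {x \<in> topspace cantor_space. g \<in> marked_cone x}"
  proof (cases "g = \<one>")
    case False
    show ?thesis
      using openin_marked_point[OF n_ge_2 open1] by (simp add: top *(1)[OF False])
  qed (simp add: one)
  show "openin cantor_space {x \<in> topspace cantor_space. g \<notin> marked_cone x}"
  proof (cases "g = \<one>")
    case False
    show ?thesis
      using openin_marked_point[OF n_ge_2 open2] by (simp add: top *(2)[OF False])
  qed (simp add: one)
qed

lemma ex_act_iff: "(\<exists>g\<in>carrier G. act g t = s) \<longleftrightarrow> tail_eq (digit n t) (digit n s)"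
  unfolding tail_eq_digit_iff[OF n_ge_2]
proof
  assume "\<exists>g\<in>carrier G. act g t = s"
  then show "\<exists>k. \<exists>x\<in>nadic n. s = x + real n powi k * t"
    using pt_nadic unfolding act_def by blast
next
  assume "\<exists>k. \<exists>x\<in>nadic n. s = x + real n powi k * t"
  then obtain k x where "x \<in> nadic n" "s = x + real n powi k * t" by blast
  then show "\<exists>g\<in>carrier G. act g t = s"
    using elt[of x k] by (intro bexI[of _ "elt x k"]) (simp_all add: act_def)
qed

lemma E_lo_marked_cone: "E_lo G (marked_cone x) (marked_cone y) \<longleftrightarrow> E0 x y"
  unfolding marked_cone_def E_lo_cone_at ex_act_iff digit_marked_point[OF n_ge_2]
  by (rule tail_eq_marker_iff)

text \<open>
Cones of points are conjugate exactly when the points are in one orbit, and for marked points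
this is \<open>E0\<close>.
\<close>

theorem E0_reducible_to_E_lo: "borel_reducible cantor_space E0 (LO_topology G) (E_lo G)"
  unfolding borel_reducible_def
proof (intro bexI[of _ marked_cone] ballI)
  show "marked_cone \<in> measurable (borel_of cantor_space) (borel_of (LO_topology G))"
    by (rule measurable_borel_of_if_continuous_map[OF continuous_marked_cone])
qed (simp add: E_lo_marked_cone)

theorem E_lo_not_smooth: "\<not> smooth_on TYPE('y) (LO_topology G) (E_lo G)"
proof
  assume "smooth_on TYPE('y) (LO_topology G) (E_lo G)"
  then obtain Y :: "'y measure" and \<theta> where Y: "standard_borel Y"
    and \<theta>: "\<theta> \<in> measurable (borel_of (LO_topology G)) Y"
    and E: "\<And>P Q. P \<in> LO G \<Longrightarrow> Q \<in> LO G \<Longrightarrow> E_lo G P Q \<longleftrightarrow> \<theta> P = \<theta> Q"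
    unfolding smooth_on_def topspace_LO_topology by blast
  have "\<theta> \<circ> marked_cone \<in> measurable (borel_of cantor_space) Y"
    by (rule measurable_comp[OF measurable_borel_of_if_continuous_map[OF continuous_marked_cone] \<theta>])
  moreover have "E0 x y \<longleftrightarrow> (\<theta> \<circ> marked_cone) x = (\<theta> \<circ> marked_cone) y" for x y
    using E[of "marked_cone x" "marked_cone y"] cone_at_LO by (simp add: marked_cone_def flip: E_lo_marked_cone)
  ultimately have "smooth_on TYPE('y) cantor_space E0"
    unfolding smooth_on_def using Y by (intro exI[of _ Y] exI[of _ "\<theta> \<circ> marked_cone"]) simp
  then show False using E0_not_smooth by blast
qed

text \<open>
The digits of a finite point.  The infinite points, each fixed by the group, get constant
sequences with letters that are not digits.
\<close>

definition itinerary :: "ereal \<Rightarrow> nat \<Rightarrow> nat" where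
  "itinerary t i = (if t = \<infinity> then n else if t = - \<infinity> then Suc n else digit n (real_of_ereal t) i)"

lemma itinerary_simps:
  "itinerary (ereal t) i = digit n t i" "itinerary \<infinity> i = n" "itinerary (- \<infinity>) i = Suc n"
  by (simp_all add: itinerary_def)

lemma itinerary_less: "itinerary t i < n + 2"
  using digit_less[of n "real_of_ereal t" i] n_ge_2 by (simp add: itinerary_def)

lemma tail_eq_itinerary:
  "tail_eq (itinerary t) (itinerary s) \<longleftrightarrow> (\<exists>g\<in>carrier G. s = extended_act g t)"
proof -
  have neq: "digit n r i \<noteq> n" "digit n r i \<noteq> Suc n" for r i
    using digit_less[of n r i] n_ge_2 by simp_all
  have fin: "itinerary (ereal r) = digit n r" for r
    by (simp add: itinerary_simps fun_eq_iff)
  have "tail_eq (digit n r) (digit n q) \<longleftrightarrow> (\<exists>g\<in>carrier G. q = act g r)" for q r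
    using ex_act_iff[of r q] by (auto simp: eq_commute)
  then show ?thesis
    by (cases t; cases s)
      (auto simp: fin extended_act_simps, auto simp: tail_eq_def itinerary_simps neq neq[symmetric])
qed

text \<open>
The two signs are repeated in each letter, so they can be read off any tail.
\<close>

definition cone_code :: "'a set \<Rightarrow> nat \<Rightarrow> nat" where
  "cone_code P i = 4 * itinerary (axis (upright P)) i + 2 * of_bool (elt 1 0 \<in> P)
    + of_bool (axis_positive (upright P))"

lemma cone_code_less: "cone_code P i < 4 * n + 8"
  using itinerary_less[of "axis (upright P)" i] by (simp add: cone_code_def)

lemma tail_eq_cone_code:
  assumes "P \<in> LO G" "Q \<in> LO G"
  shows "tail_eq (cone_code P) (cone_code Q) \<longleftrightarrow> E_lo G P Q"
proof -
  have "4 * a + 2 * of_bool p + of_bool q = 4 * b + 2 * of_bool p' + of_bool q' \<longleftrightarrow>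
      a = b \<and> p = p' \<and> q = q'" for a b :: nat and p q p' q'
    by (cases p; cases q; cases p'; cases q') (simp_all, presburger+)
  then have "tail_eq (cone_code P) (cone_code Q) \<longleftrightarrow> (elt 1 0 \<in> P \<longleftrightarrow> elt 1 0 \<in> Q) \<and>
      (axis_positive (upright P) \<longleftrightarrow> axis_positive (upright Q)) \<and>
      tail_eq (itinerary (axis (upright P))) (itinerary (axis (upright Q)))"
    by (auto simp: tail_eq_def cone_code_def)
  then show ?thesis
    unfolding E_lo_classification[OF assms] tail_eq_itinerary by blast
qed

lemma measurable_upright:
  assumes g: "g \<in> carrier G"
  shows "Measurable.pred (borel_of (LO_topology G)) (\<lambda>P. g \<in> upright P)"
proof -
  have one: "elt 1 0 \<in> carrier G"
    using elt_carrier[of 1 0] nadic_of_int[of 1] by simp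
  note [measurable] = measurable_LO_mem[OF g] measurable_LO_mem[OF inv_closed[OF g]] measurable_LO_mem[OF one]
  have "Measurable.pred (borel_of (LO_topology G)) (\<lambda>P. if elt 1 0 \<in> P then g \<in> P else inv g \<in> P)"
    by measurable
  moreover have "(if elt 1 0 \<in> P then g \<in> P else inv g \<in> P) \<longleftrightarrow> g \<in> upright P"
    if "P \<in> space (borel_of (LO_topology G))" for P
    using that g set_inv_iff[OF LO_D(1), of P]
    by (simp add: upright_def space_borel_of topspace_LO_topology)
  ultimately show ?thesis
    by (simp cong: measurable_cong)
qed

lemma measurable_axis: "(\<lambda>P. axis (upright P)) \<in> borel_measurable (borel_of (LO_topology G))"
  unfolding axis_def
proof (rule borel_measurable_SUP[OF countable_nadic])
  fix y assume "y \<in> nadic n"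
  note [measurable] = measurable_upright[OF homothety(1)[OF this]]
  show "(\<lambda>P. if homothety y \<in> upright P then ereal y else - \<infinity>) \<in> borel_measurable (borel_of (LO_topology G))"
    by measurable
qed

lemma measurable_cone_code:
  "(\<lambda>P. cone_code P i) \<in> measurable (borel_of (LO_topology G)) (count_space UNIV)"
proof -
  have one: "elt 1 0 \<in> carrier G"
    using elt_carrier[of 1 0] nadic_of_int[of 1] by simp
  note [measurable] = measurable_axis measurable_LO_mem[OF one]
  have "(\<lambda>P. itinerary (axis (upright P)) i) \<in> measurable (borel_of (LO_topology G)) (count_space UNIV)"
    unfolding itinerary_def digit_def by measurable
  moreover have "Measurable.pred (borel_of (LO_topology G)) (\<lambda>P. axis_positive (upright P))"
  proof -
    have "axis_positive (upright P) \<longleftrightarrow> (\<exists>g\<in>carrier G. g \<in> upright P \<and> ht g > 0 \<and> ereal (fixed_point g) = axis (upright P))"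
      if "P \<in> space (borel_of (LO_topology G))" for P
      using that LO_D(2)[OF upright(1)] unfolding axis_positive_def
      by (auto simp: space_borel_of topspace_LO_topology)
    moreover have "Measurable.pred (borel_of (LO_topology G))
        (\<lambda>P. \<exists>g\<in>carrier G. g \<in> upright P \<and> ht g > 0 \<and> ereal (fixed_point g) = axis (upright P))"
    proof -
      let ?M = "borel_of (LO_topology G)"
      let ?A = "\<lambda>g. {P \<in> space ?M. g \<in> upright P \<and> ht g > 0 \<and> ereal (fixed_point g) = axis (upright P)}"
      have "?A g \<in> sets ?M" if "g \<in> carrier G" for g
      proof -
        note [measurable] = measurable_upright[OF that]
        show ?thesis by measurable
      qed
      then have "(\<Union>g\<in>carrier G. ?A g) \<in> sets ?M"
        by (intro sets.countable_UN'[OF countable_carrier]) blast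
      also have "(\<Union>g\<in>carrier G. ?A g) = {P \<in> space ?M. \<exists>g\<in>carrier G. g \<in> upright P \<and>
          ht g > 0 \<and> ereal (fixed_point g) = axis (upright P)}"
        by blast
      finally show ?thesis by (simp add: pred_def)
    qed
    ultimately show ?thesis
      by (simp cong: measurable_cong)
  qed
  ultimately show ?thesis
    unfolding cone_code_def by measurable
qed

text \<open>
By the classification, \<open>E_lo\<close> is tail equivalence of the codes, which use a finite alphabet.
\<close>

theorem E_lo_reducible_to_E0: "borel_reducible (LO_topology G) (E_lo G) cantor_space E0"
  unfolding borel_reducible_def
proof (intro bexI[of _ "\<lambda>P. graph_code (tail_code (cone_code P))"] ballI)
  show "(\<lambda>P. graph_code (tail_code (cone_code P))) \<in> measurable (borel_of (LO_topology G)) (borel_of cantor_space)"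
    by (rule measurable_graph_code_tail_code[OF measurable_cone_code])
  fix P Q assume "P \<in> topspace (LO_topology G)" "Q \<in> topspace (LO_topology G)"
  then have "E_lo G P Q \<longleftrightarrow> tail_eq (cone_code P) (cone_code Q)"
    by (simp add: topspace_LO_topology tail_eq_cone_code)
  also have "\<dots> \<longleftrightarrow> E0 (graph_code (tail_code (cone_code P))) (graph_code (tail_code (cone_code Q)))"
    by (rule tail_eq_iff_E0[of _ "4 * n + 8"]) (simp_all add: cone_code_less)
  finally show "E_lo G P Q \<longleftrightarrow> E0 (graph_code (tail_code (cone_code P))) (graph_code (tail_code (cone_code Q)))" .
qed

end

theorem theorem1p1:
  shows "(\<forall>n::nat. n \<ge> 2 \<longrightarrow>
            \<not> smooth_on TYPE('y) (LO_topology (BS1 n)) (E_lo (BS1 n))) \<and>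
         borel_bireducible (LO_topology (BS1 2)) (E_lo (BS1 2)) cantor_space E0"
proof (intro conjI allI impI)
  show "\<not> smooth_on TYPE('y) (LO_topology (BS1 n)) (E_lo (BS1 n))" if "n \<ge> 2" for n :: nat
    by (rule affine_coordinates.E_lo_not_smooth[OF affine_coordinates_BS1[OF that]])
  show "borel_bireducible (LO_topology (BS1 2)) (E_lo (BS1 2)) cantor_space E0"
    unfolding borel_bireducible_def
    using affine_coordinates.E_lo_reducible_to_E0[OF affine_coordinates_BS1[of 2]]
      affine_coordinates.E0_reducible_to_E_lo[OF affine_coordinates_BS1[of 2]] by simp
qed

end
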